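(* Let $G_1,\ldots,G_t$ be finite groups, where $t\geq 1$, and put $\mathcal{W}=\mathsf{V}\bigl(\mathcal{P}(G_1)^0,\ldots,\mathcal{P}(G_t)^0\bigr)$. Let $H$ be a finite group with $|H|\geq 3$. Then every ai-semiring variety $\mathcal{V}$ satisfying $\mathsf{V}(\mathcal{P}(H))\subseteq\mathcal{V}\subseteq\mathcal{W}$ has infinite axiomatic rank and is nonfinitely based.
   Context: An additively idempotent semiring (ai-semiring) is an algebra $(S,+,\cdot)$ with two binary operations (no constants in the signature) such that $(S,+)$ is a commutative idempotent semigroup, $(S,\cdot)$ is a semigroup, and multiplication distributes over addition on both sides. For a semigroup $S$, $\mathcal{P}(S)$ is the ai-semiring of all nonempty subsets of $S$ with $A+B=A\cup B$ and $AB=\{ab:a\in A,\ b\in B\}$; $\mathcal{P}(S)^0$ is the ai-semiring of all subsets of $S$ (including $\varnothing$) with the same operations. For ai-semirings $S_1,S_2,\ldots$, $\mathsf{V}(S_1,S_2,\ldots)$ is the variety they generate. Terms use variables from a countably infinite set. A variety is finitely based if its identities admit a finite basis, and nonfinitely based otherwise. A variety has infinite axiomatic rank if, for every positive integer $k$, its identities involving at most $k$ variables do not form a basis for all its identities. *)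

theory Defs
  imports "HOL-Algebra.Coset" "HOL-Library.Infinite_Typeclass"
begin

record 'a sr_alg = "'a partial_object" +
  splus :: "'a \<Rightarrow> 'a \<Rightarrow> 'a"
  stimes :: "'a \<Rightarrow> 'a \<Rightarrow> 'a"

locale ai_semiring =
  fixes S :: "'a sr_alg"
  assumes nonempty: "carrier S \<noteq> {}"
    and splus_closed: "\<lbrakk>x \<in> carrier S; y \<in> carrier S\<rbrakk> \<Longrightarrow> splus S x y \<in> carrier S"
    and stimes_closed: "\<lbrakk>x \<in> carrier S; y \<in> carrier S\<rbrakk> \<Longrightarrow> stimes S x y \<in> carrier S"
    and splus_assoc: "\<lbrakk>x \<in> carrier S; y \<in> carrier S; z \<in> carrier S\<rbrakk>
      \<Longrightarrow> splus S (splus S x y) z = splus S x (splus S y z)"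
    and splus_commute: "\<lbrakk>x \<in> carrier S; y \<in> carrier S\<rbrakk> \<Longrightarrow> splus S x y = splus S y x"
    and splus_idem: "x \<in> carrier S \<Longrightarrow> splus S x x = x"
    and stimes_assoc: "\<lbrakk>x \<in> carrier S; y \<in> carrier S; z \<in> carrier S\<rbrakk>
      \<Longrightarrow> stimes S (stimes S x y) z = stimes S x (stimes S y z)"
    and distrib_left: "\<lbrakk>x \<in> carrier S; y \<in> carrier S; z \<in> carrier S\<rbrakk>
      \<Longrightarrow> stimes S x (splus S y z) = splus S (stimes S x y) (stimes S x z)"
    and distrib_right: "\<lbrakk>x \<in> carrier S; y \<in> carrier S; z \<in> carrier S\<rbrakk>
      \<Longrightarrow> stimes S (splus S x y) z = splus S (stimes S x z) (stimes S y z)"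

definition power_semiring :: "('a, 'm) monoid_scheme \<Rightarrow> 'a set sr_alg" where
  "power_semiring G =
    \<lparr>carrier = {A. A \<subseteq> carrier G \<and> A \<noteq> {}}, splus = (\<union>), stimes = set_mult G\<rparr>"

definition power_semiring0 :: "('a, 'm) monoid_scheme \<Rightarrow> 'a set sr_alg" where
  "power_semiring0 G = \<lparr>carrier = Pow (carrier G), splus = (\<union>), stimes = set_mult G\<rparr>"

datatype sr_term = Var nat | Plus sr_term sr_term | Times sr_term sr_term

type_synonym identity = "sr_term \<times> sr_term"

primrec eval_term :: "'a sr_alg \<Rightarrow> (nat \<Rightarrow> 'a) \<Rightarrow> sr_term \<Rightarrow> 'a" where
  "eval_term S \<phi> (Var n) = \<phi> n"
| "eval_term S \<phi> (Plus p q) = splus S (eval_term S \<phi> p) (eval_term S \<phi> q)"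
| "eval_term S \<phi> (Times p q) = stimes S (eval_term S \<phi> p) (eval_term S \<phi> q)"

primrec term_vars :: "sr_term \<Rightarrow> nat set" where
  "term_vars (Var n) = {n}"
| "term_vars (Plus p q) = term_vars p \<union> term_vars q"
| "term_vars (Times p q) = term_vars p \<union> term_vars q"

definition identity_vars :: "identity \<Rightarrow> nat set" where
  "identity_vars e = term_vars (fst e) \<union> term_vars (snd e)"

definition satisfies :: "'a sr_alg \<Rightarrow> identity \<Rightarrow> bool" where
  "satisfies S e \<longleftrightarrow>
    (\<forall>\<phi>. (\<forall>n. \<phi> n \<in> carrier S) \<longrightarrow> eval_term S \<phi> (fst e) = eval_term S \<phi> (snd e))"

definition identities :: "'a sr_alg set \<Rightarrow> identity set" where
  "identities K = {e. \<forall>S\<in>K. satisfies S e}"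

definition models :: "identity set \<Rightarrow> 'a sr_alg set" where
  "models \<Sigma> = {S. ai_semiring S \<and> (\<forall>e\<in>\<Sigma>. satisfies S e)}"

text \<open>
  Varieties are equational classes of ai-semirings. Since a class cannot range over all types, it
  is cut down to the algebras whose carrier is a set of elements of one type \<open>'u\<close>. As soon as
  \<open>'u\<close> is infinite nothing is lost: the free algebra of a variety on countably many generators is
  countable, so it has a copy over \<open>'u\<close>, and that copy determines the identities of the variety.
\<close>

definition variety :: "'u::infinite sr_alg set \<Rightarrow> bool" where
  "variety V \<longleftrightarrow> (\<exists>\<Sigma>. V = models \<Sigma>)"

text \<open>
  The intersection of all varieties that contain \<open>K\<close>. The members of \<open>K\<close> and of the generated
  variety may have carriers in different types; a variety is referred to across the two types
  by a set of identities that defines it.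
\<close>

definition generated_variety :: "'a sr_alg set \<Rightarrow> 'u::infinite sr_alg set" where
  "generated_variety K = \<Inter> {models \<Sigma> | \<Sigma>. K \<subseteq> models \<Sigma>}"

text \<open>
  The ai-semiring axioms, which are finitely many identities in at most three variables, need not
  be listed in a basis: consequences are taken within the class of ai-semirings.
\<close>

definition is_basis :: "identity set \<Rightarrow> 'u::infinite sr_alg set \<Rightarrow> bool" where
  "is_basis \<Sigma> V \<longleftrightarrow> \<Sigma> \<subseteq> identities V \<and>
    (\<forall>S :: 'u sr_alg. S \<in> models \<Sigma> \<longrightarrow> (\<forall>e\<in>identities V. satisfies S e))"

definition finitely_based :: "'u::infinite sr_alg set \<Rightarrow> bool" where
  "finitely_based V \<longleftrightarrow> (\<exists>\<Sigma>. finite \<Sigma> \<and> is_basis \<Sigma> V)"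

definition infinite_axiomatic_rank :: "'u::infinite sr_alg set \<Rightarrow> bool" where
  "infinite_axiomatic_rank V \<longleftrightarrow>
    (\<forall>k>0. \<not> is_basis {e \<in> identities V. card (identity_vars e) \<le> k} V)"

lemma set_mult_Un:
  "A <#>\<^bsub>G\<^esub> (B \<union> C) = (A <#>\<^bsub>G\<^esub> B) \<union> (A <#>\<^bsub>G\<^esub> C)"
  "(A \<union> B) <#>\<^bsub>G\<^esub> C = (A <#>\<^bsub>G\<^esub> C) \<union> (B <#>\<^bsub>G\<^esub> C)"
  unfolding set_mult_def by auto

lemma ai_semiring_power_semiring0:
  assumes "group G"
  shows "ai_semiring (power_semiring0 G)"
proof -
  interpret group G by fact
  show ?thesis
  proof (unfold_locales, goal_cases)
    case 1
    show ?case
      by (auto simp: power_semiring0_def)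
  next
    case (3 x y)
    then show ?case
      using set_mult_closed by (simp add: power_semiring0_def)
  next
    case (7 x y z)
    then show ?case
      by (simp add: power_semiring0_def set_mult_assoc)
  qed (simp_all add: power_semiring0_def set_mult_Un Un_ac)
qed

lemma ai_semiring_power_semiring:
  assumes "group G"
  shows "ai_semiring (power_semiring G)"
proof -
  interpret group G by fact
  show ?thesis
  proof (unfold_locales, goal_cases)
    case 1
    show ?case
      using one_closed by (auto simp: power_semiring_def)
  next
    case (3 x y)
    then have "x <#>\<^bsub>G\<^esub> y \<noteq> {}"
      by (simp add: power_semiring_def set_mult_def)
    with 3 show ?case
      using set_mult_closed by (simp add: power_semiring_def)
  next
    case (7 x y z)
    then show ?case
      by (simp add: power_semiring_def set_mult_assoc)
  qed (simp_all add: power_semiring_def set_mult_Un Un_ac)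
qed

lemma generated_variety_eq:
  assumes "\<And>S. S \<in> K \<Longrightarrow> ai_semiring S"
  shows "generated_variety K = models (identities K)"
proof
  have "K \<subseteq> models (identities K)"
    using assms by (auto simp: models_def identities_def)
  then show "generated_variety K \<subseteq> models (identities K)"
    unfolding generated_variety_def by (intro Inter_lower) auto
  have "models (identities K) \<subseteq> models \<Sigma>" if "K \<subseteq> models \<Sigma>" for \<Sigma>
  proof -
    have "\<Sigma> \<subseteq> identities K"
      using that by (auto simp: models_def identities_def)
    then show ?thesis
      by (auto simp: models_def)
  qed
  then show "models (identities K) \<subseteq> generated_variety K"
    unfolding generated_variety_def by (intro Inter_greatest) auto
qed

lemma variety_generated_variety:
  assumes "\<And>S. S \<in> K \<Longrightarrow> ai_semiring S"
  shows "variety (generated_variety K)"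
  unfolding variety_def using generated_variety_eq[OF assms] by metis

end

(*
  A word that is linear in its variables lies below a sum of words in the power semiring of a group
  as soon as each choice of group elements makes it equal to one of these words.  Reading the partial
  products of x_0 ... x_(M-1) as a colouring of the positions by group elements, a graph E on the
  positions whose chromatic number exceeds all |G_i| yields the identity
    x_0 ... x_(M-1)  <=  SUM over (i,j) in E of  x_0 ... x_(i-1) x_j ... x_(M-1)
  of all P(G_i)^0.  It fails in the commutative semiring S of sets of multisets over {0..<M} modulo the
  residuals with respect to the multisets on the right-hand side.  An identity of P(H) in few variables
  holds in S: it involves only a few edges, which E is chosen to make 2-colourable, and |H| >= 3 leaves
  enough freedom.  Either a word is hit by giving some variables the value H - {h} and the others
  the value {1}, or the letters become differences of a proper colouring with values in an abelian
  subgroup, adjusted so that the word gets the value h.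
*)
theory Submission
  imports Defs "HOL-Library.Multiset" "HOL-Library.Product_Plus"
begin

section \<open>A graph of large chromatic number with bipartite small subgraphs\<close>

text \<open>These lists are the vertices of a shift graph: an increasing list \<open>z\<close> with
  one more entry is the edge between \<open>butlast z\<close> and \<open>tl z\<close>.\<close>

definition inc_lists :: "nat \<Rightarrow> nat \<Rightarrow> nat list set" where
  "inc_lists n r = {z. length z = r \<and> sorted_wrt (<) z \<and> set z \<subseteq> {..<n}}"

lemma finite_inc_lists: "finite (inc_lists n r)"
  by (rule finite_subset[OF _ finite_lists_length_eq[of "{..<n}" r]]) (auto simp: inc_lists_def)

lemma butlast_inc_lists: "z \<in> inc_lists n (Suc r) \<Longrightarrow> butlast z \<in> inc_lists n r"
  by (auto simp: inc_lists_def butlast_conv_take sorted_wrt_take dest: in_set_takeD)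

lemma tl_inc_lists: "z \<in> inc_lists n (Suc r) \<Longrightarrow> tl z \<in> inc_lists n r"
  by (cases z) (auto simp: inc_lists_def)

text \<open>Glues two lists that overlap in \<open>tl z\<close>, giving an edge from
  \<open>z\<close> to \<open>z'\<close>. The overlap is nonempty, which keeps the glued list
  increasing.\<close>

lemma Cons_inc_lists:
  assumes "z \<in> inc_lists n (Suc (Suc r))" "z' \<in> inc_lists n (Suc (Suc r))" "butlast z' = tl z"
  shows "hd z # z' \<in> inc_lists n (Suc (Suc (Suc r)))" "butlast (hd z # z') = z"
proof -
  obtain a b y where z: "z = a # b # y"
    using assms(1) by (cases z; cases "tl z") (auto simp: inc_lists_def)
  then obtain y' where z': "z' = b # y'"
    using assms(2,3) by (cases z'; cases "tl z'") (auto simp: inc_lists_def)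
  show "hd z # z' \<in> inc_lists n (Suc (Suc (Suc r)))"
    using assms(1,2) unfolding z z' by (auto simp: inc_lists_def)
  show "butlast (hd z # z') = z"
    using assms(3) unfolding z z' by auto
qed

text \<open>A colour of an increasing list is traded for the set of colours of its one-step prolongations.\<close>

lemma shift_graph_chromatic:
  "\<exists>n. \<forall>c :: nat list \<Rightarrow> nat. c ` inc_lists n (Suc r) \<subseteq> {..<N} \<longrightarrow>
     (\<exists>z \<in> inc_lists n (Suc (Suc r)). c (butlast z) = c (tl z))"
proof (induction r arbitrary: N)
  case 0
  have "\<exists>z \<in> inc_lists (Suc N) (Suc (Suc 0)). c (butlast z) = c (tl z)"
    if c: "c ` inc_lists (Suc N) (Suc 0) \<subseteq> {..<N}" for c :: "nat list \<Rightarrow> nat"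
  proof -
    \<comment> \<open>Lists of length one form a complete graph, so this case is the pigeonhole
      principle.\<close>
    have "(\<lambda>a. c [a]) ` {..<Suc N} \<subseteq> {..<N}"
      using c by (force simp: inc_lists_def image_subset_iff)
    then have "\<not> inj_on (\<lambda>a. c [a]) {..<Suc N}"
      by (metis card_inj_on_le card_lessThan finite_lessThan lessI not_le)
    then obtain a b where "a < Suc N" "b < Suc N" "a < b" "c [a] = c [b]"
      by (auto simp: inj_on_def) (metis linorder_neqE_nat)
    then show ?thesis
      by (intro bexI[of _ "[a, b]"]) (auto simp: inc_lists_def)
  qed
  then show ?case by blast
next
  case (Suc r)
  \<comment> \<open>The new colours are sets of old ones; they are numbered so that the induction
    hypothesis applies with \<open>2^N\<close> in place of \<open>N\<close>.\<close>
  obtain enc :: "nat set \<Rightarrow> nat" where enc: "bij_betw enc (Pow {..<N}) {0..<card (Pow {..<N})}"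
    using ex_bij_betw_finite_nat[of "Pow {..<N}"] by auto
  from Suc obtain n where n: "\<And>c :: nat list \<Rightarrow> nat.
      c ` inc_lists n (Suc r) \<subseteq> {..<card (Pow {..<N})} \<Longrightarrow>
      (\<exists>z \<in> inc_lists n (Suc (Suc r)). c (butlast z) = c (tl z))"
    by blast
  have "\<exists>z \<in> inc_lists n (Suc (Suc (Suc r))). c (butlast z) = c (tl z)"
    if c: "c ` inc_lists n (Suc (Suc r)) \<subseteq> {..<N}" for c :: "nat list \<Rightarrow> nat"
  proof -
    define c' where "c' u = {c z | z. z \<in> inc_lists n (Suc (Suc r)) \<and> butlast z = u}" for u
    have c': "c' u \<in> Pow {..<N}" for u
      using c by (auto simp: c'_def)
    then have "(\<lambda>u. enc (c' u)) ` inc_lists n (Suc r) \<subseteq> {..<card (Pow {..<N})}"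
      using bij_betw_apply[OF enc] by fastforce
    from n[OF this] obtain z where z: "z \<in> inc_lists n (Suc (Suc r))"
      and "enc (c' (butlast z)) = enc (c' (tl z))" by blast
    then have "c' (butlast z) = c' (tl z)"
      using enc c' by (meson bij_betw_imp_inj_on inj_onD)
    \<comment> \<open>Equality of the two colour sets gives \<open>z\<close> a successor
      \<open>z'\<close> of the same colour; gluing \<open>z\<close> to \<open>z'\<close> yields the
      edge.\<close>
    moreover have "c z \<in> c' (butlast z)"
      using z by (auto simp: c'_def)
    ultimately have "c z \<in> c' (tl z)" by simp
    then obtain z' where z': "z' \<in> inc_lists n (Suc (Suc r))" "butlast z' = tl z" "c z = c z'"
      by (auto simp: c'_def)
    show ?thesis
      using Cons_inc_lists[OF z z'(1,2)] z'(3) by (intro bexI[of _ "hd z # z'"]) auto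
  qed
  then show ?case by blast
qed

text \<open>
  Within a component with few edges the middle entry of a fixed vertex never leaves the window,
  and every edge moves its index by one; the parity of that index is a proper 2-colouring.
\<close>

lemma shift_graph_bipartite:
  assumes R: "R \<subseteq> inc_lists n (Suc (4 * K + 1))" "card R \<le> K"
  shows "\<exists>\<epsilon> :: nat list \<Rightarrow> bool. \<forall>z\<in>R. \<epsilon> (butlast z) \<noteq> \<epsilon> (tl z)"
proof -
  define r where "r = 4 * K + 1"
  have len: "length z = Suc r" and srt: "sorted_wrt (<) z" if "z \<in> R" for z
    using R that by (auto simp: inc_lists_def r_def)
  have finR: "finite R"
    using R finite_inc_lists finite_subset by blast
  \<comment> \<open>\<open>Q\<close> is the symmetric adjacency relation of the edges in
    \<open>R\<close>, so \<open>Q\<^sup>*\<close> is connectedness.\<close>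
  define Q where "Q = (\<lambda>z. (butlast z, tl z)) ` R \<union> (\<lambda>z. (tl z, butlast z)) ` R"
  have finQ: "finite Q"
    using finR by (simp add: Q_def)
  have cardQ: "card Q \<le> 2 * K"
  proof -
    have "card Q \<le> card ((\<lambda>z. (butlast z, tl z)) ` R) + card ((\<lambda>z. (tl z, butlast z)) ` R)"
      unfolding Q_def by (rule card_Un_le)
    also have "\<dots> \<le> card R + card R"
      using card_image_le[OF finR] by (intro add_mono)
    finally show ?thesis using R(2) by simp
  qed
  have lenQ: "length v = length u" if "(v, u) \<in> Q\<^sup>*" for v u
    using that by induction (auto simp: Q_def)
  \<comment> \<open>All vertices of a component give \<open>SOME\<close> the same predicate, hence
    the same root.\<close>
  define root where "root u = (SOME v. (v, u) \<in> Q\<^sup>*)" for u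
  have root: "(root u, u) \<in> Q\<^sup>*" for u
    unfolding root_def by (rule someI[of _ u]) simp
  have root_eq: "root (butlast z) = root (tl z)" if "z \<in> R" for z
  proof -
    have "(butlast z, tl z) \<in> Q" "(tl z, butlast z) \<in> Q"
      using that by (auto simp: Q_def)
    then have "(\<lambda>v. (v, butlast z) \<in> Q\<^sup>*) = (\<lambda>v. (v, tl z) \<in> Q\<^sup>*)"
      by (meson rtrancl.rtrancl_into_rtrancl)
    then show ?thesis by (simp add: root_def)
  qed
  \<comment> \<open>Each step moves the index of the tracked entry by one. Starting at
    \<open>2 * K\<close> among \<open>4 * K + 1\<close> positions, it cannot leave the list within
    \<open>2 * K\<close> steps.\<close>
  have track: "\<exists>i. i < r \<and> u ! i = v ! (2 * K) \<and> i \<le> 2 * K + m \<and> 2 * K \<le> i + m"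
    if "(v, u) \<in> Q ^^ m" "m \<le> 2 * K" for v u m
    using that
  proof (induction m arbitrary: u)
    case 0
    then show ?case by (intro exI[of _ "2 * K"]) (auto simp: r_def)
  next
    case (Suc m)
    then obtain u' where u': "(v, u') \<in> Q ^^ m" "(u', u) \<in> Q" by auto
    then obtain i where i: "i < r" "u' ! i = v ! (2 * K)" "i \<le> 2 * K + m" "2 * K \<le> i + m"
      using Suc by auto
    from u'(2) obtain z where z: "z \<in> R"
      and "u' = butlast z \<and> u = tl z \<or> u' = tl z \<and> u = butlast z"
      by (auto simp: Q_def)
    then consider "u' = butlast z" "u = tl z" | "u' = tl z" "u = butlast z" by blast
    then show ?case
    proof cases
      case 1
      have "i \<ge> 1" using i Suc.prems by simp
      then show ?thesis
        using 1 i len[OF z] Suc.prems by (intro exI[of _ "i - 1"]) (auto simp: nth_tl nth_butlast)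
    next
      case 2
      have "Suc i < r" using i Suc.prems by (simp add: r_def)
      then show ?thesis
        using 2 i len[OF z] Suc.prems by (intro exI[of _ "Suc i"]) (auto simp: nth_tl nth_butlast)
    qed
  qed
  have ex: "\<exists>i < r. u ! i = root u ! (2 * K)" for u
  proof -
    have "(root u, u) \<in> (\<Union>m\<in>{m. m \<le> card Q}. Q ^^ m)"
      using root[of u] rtrancl_finite_eq_relpow[OF finQ] by simp
    then obtain m where "(root u, u) \<in> Q ^^ m" "m \<le> 2 * K"
      using cardQ by auto
    then show ?thesis using track by blast
  qed
  define idx where "idx u = (SOME i. i < r \<and> u ! i = root u ! (2 * K))" for u
  have idx: "idx u < r" "u ! idx u = root u ! (2 * K)" for u
    using someI_ex[OF ex[of u]] unfolding idx_def by auto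
  have "even (idx (butlast z)) \<noteq> even (idx (tl z))" if z: "z \<in> R" for z
  proof -
    have "z ! idx (butlast z) = butlast z ! idx (butlast z)"
      using idx(1)[of "butlast z"] len[OF z] by (simp add: nth_butlast)
    also have "\<dots> = tl z ! idx (tl z)"
      using idx(2) root_eq[OF z] by metis
    also have "\<dots> = z ! Suc (idx (tl z))"
      using idx(1)[of "tl z"] len[OF z] by (simp add: nth_tl)
    finally have "z ! idx (butlast z) = z ! Suc (idx (tl z))" .
    \<comment> \<open>Distinctness turns equal entries into equal positions of \<open>z\<close>; the
      shift by \<open>tl\<close> makes the two indices differ by one.\<close>
    moreover have "distinct z"
      using srt[OF z] by (simp add: strict_sorted_iff)
    ultimately have "idx (butlast z) = Suc (idx (tl z))"
      using idx(1)[of "tl z"] idx(1)[of "butlast z"] len[OF z]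
      by (simp add: nth_eq_iff_index_eq)
    then show ?thesis by simp
  qed
  then show ?thesis by (intro exI[of _ "\<lambda>u. even (idx u)"]) blast
qed

text \<open>Transports the shift graph to the vertices \<open>0..<M\<close>, the positions of a
  word. Edges are ordered because \<open>(i, j)\<close> will stand for deleting the block
  \<open>{i..<j}\<close>.\<close>

lemma ex_locally_bipartite_graph:
  fixes N K :: nat
  obtains M :: nat and E :: "(nat \<times> nat) set"
  where "\<And>i j. (i, j) \<in> E \<Longrightarrow> i < j \<and> j < M"
    and "\<And>c :: nat \<Rightarrow> nat. c ` {..<M} \<subseteq> {..<N} \<Longrightarrow> \<exists>(i, j) \<in> E. c i = c j"
    and "\<And>R. R \<subseteq> E \<Longrightarrow> card R \<le> K \<Longrightarrow> \<exists>\<epsilon> :: nat \<Rightarrow> bool. \<forall>(i, j) \<in> R. \<epsilon> i \<noteq> \<epsilon> j"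
proof -
  define r where "r = 4 * K"
  obtain n where n: "\<And>c :: nat list \<Rightarrow> nat. c ` inc_lists n (Suc r) \<subseteq> {..<N} \<Longrightarrow>
      (\<exists>z \<in> inc_lists n (Suc (Suc r)). c (butlast z) = c (tl z))"
    using shift_graph_chromatic by meson
  define V where "V = inc_lists n (Suc r)"
  define M where "M = card V"
  obtain b where b: "bij_betw b V {0..<M}"
    using ex_bij_betw_finite_nat[of V] finite_inc_lists by (auto simp: V_def M_def)
  have bV: "b u < M" if "u \<in> V" for u
    using bij_betw_apply[OF b that] by simp
  have inV: "butlast z \<in> V" "tl z \<in> V" if "z \<in> inc_lists n (Suc (Suc r))" for z
    using that butlast_inc_lists tl_inc_lists by (auto simp: V_def)
  have neq: "b (butlast z) \<noteq> b (tl z)" if z: "z \<in> inc_lists n (Suc (Suc r))" for z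
  proof
    assume "b (butlast z) = b (tl z)"
    then have "butlast z = tl z"
      using inV[OF z] b by (meson bij_betw_imp_inj_on inj_onD)
    moreover obtain x y w where "z = x # y # w"
      using z by (cases z; cases "tl z") (auto simp: inc_lists_def)
    ultimately show False
      using z by (auto simp: inc_lists_def split: if_splits)
  qed
  define edge where
    "edge z = (min (b (butlast z)) (b (tl z)), max (b (butlast z)) (b (tl z)))" for z
  define E where "E = edge ` inc_lists n (Suc (Suc r))"
  have b_inv: "inv_into V b (b u) = u" if "u \<in> V" for u
    using b that by (meson bij_betw_imp_inj_on inv_into_f_f)
  show ?thesis
  proof (rule that[of E M])
    show "i < j \<and> j < M" if ij: "(i, j) \<in> E" for i j
    proof -
      obtain z where z: "z \<in> inc_lists n (Suc (Suc r))" "(i, j) = edge z"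
        using ij unfolding E_def by blast
      show ?thesis
        using z(2) neq[OF z(1)] bV[OF inV(1)[OF z(1)]] bV[OF inV(2)[OF z(1)]]
        by (auto simp: edge_def min_def max_def split: if_splits)
    qed
  next
    fix c :: "nat \<Rightarrow> nat" assume c: "c ` {..<M} \<subseteq> {..<N}"
    then have "(c \<circ> b) ` inc_lists n (Suc r) \<subseteq> {..<N}"
      using bV by (auto simp: V_def)
    from n[OF this] obtain z where "z \<in> inc_lists n (Suc (Suc r))" "c (b (butlast z)) = c (b (tl z))"
      by auto
    then show "\<exists>(i, j) \<in> E. c i = c j"
      by (auto simp: E_def edge_def min_def max_def)
  next
    fix R assume R: "R \<subseteq> E" "card R \<le> K"
    \<comment> \<open>\<open>R'\<close> contains one list for each edge of \<open>R\<close>, so the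
      bound on the cardinality carries over.\<close>
    obtain R' where R': "R' \<subseteq> inc_lists n (Suc (Suc r))" "inj_on edge R'" "R = edge ` R'"
      using R(1) unfolding E_def by (meson subset_image_inj)
    then have "card R' \<le> K"
      using R(2) by (simp add: card_image)
    with R'(1) obtain \<epsilon> :: "nat list \<Rightarrow> bool" where \<epsilon>: "\<forall>z\<in>R'. \<epsilon> (butlast z) \<noteq> \<epsilon> (tl z)"
      using shift_graph_bipartite[of R' n K] by (auto simp: r_def)
    have "\<epsilon> (inv_into V b i) \<noteq> \<epsilon> (inv_into V b j)" if "(i, j) \<in> R" for i j
    proof -
      obtain z where z: "z \<in> R'" "(i, j) = edge z"
        using \<open>(i, j) \<in> R\<close> R'(3) by blast
      then have "z \<in> inc_lists n (Suc (Suc r))" using R'(1) by blast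
      from inV[OF this] show ?thesis
        using \<epsilon> z b_inv by (auto simp: edge_def min_def max_def split: if_splits)
    qed
    then show "\<exists>\<epsilon> :: nat \<Rightarrow> bool. \<forall>(i, j) \<in> R. \<epsilon> i \<noteq> \<epsilon> j"
      by (intro exI[of _ "\<lambda>i. \<epsilon> (inv_into V b i)"]) auto
  qed
qed

section \<open>Terms and words\<close>

text \<open>By distributivity a term equals the sum of these words in every ai-semiring.\<close>

primrec words :: "sr_term \<Rightarrow> nat list set" where
  "words (Var n) = {[n]}"
| "words (Plus p q) = words p \<union> words q"
| "words (Times p q) = {u @ v | u v. u \<in> words p \<and> v \<in> words q}"

lemma words_nonempty: "words p \<noteq> {}"
  by (induction p) auto

lemma term_vars_words: "term_vars p = (\<Union>w\<in>words p. set w)"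
proof (induction p)
  case (Times p q)
  obtain u v where "u \<in> words p" "v \<in> words q"
    using words_nonempty by blast
  then show ?case using Times by fastforce
qed auto

lemma finite_term_vars: "finite (term_vars p)"
  by (induction p) auto

definition mprod :: "('a, 'm) monoid_scheme \<Rightarrow> 'a list \<Rightarrow> 'a" where
  "mprod G gs = foldr (\<otimes>\<^bsub>G\<^esub>) gs \<one>\<^bsub>G\<^esub>"

lemma mprod_simps [simp]:
  "mprod G [] = \<one>\<^bsub>G\<^esub>" "mprod G (g # gs) = g \<otimes>\<^bsub>G\<^esub> mprod G gs"
  by (simp_all add: mprod_def)

lemma (in monoid) mprod_closed: "set gs \<subseteq> carrier G \<Longrightarrow> mprod G gs \<in> carrier G"
  by (induction gs) auto

lemma (in monoid) mprod_append:
  "set gs \<subseteq> carrier G \<Longrightarrow> set hs \<subseteq> carrier G \<Longrightarrow> mprod G (gs @ hs) = mprod G gs \<otimes> mprod G hs"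
  by (induction gs) (auto simp: mprod_closed m_assoc)

lemma (in monoid) mprod_ones: "set gs \<subseteq> {\<one>} \<Longrightarrow> mprod G gs = \<one>"
  by (induction gs) auto

text \<open>Each occurrence of a variable chooses its own element, so a repeated letter can
  contribute different factors.\<close>

definition word_sets :: "(nat \<Rightarrow> 'a set) \<Rightarrow> nat list \<Rightarrow> 'a list set" where
  "word_sets \<phi> w = {gs. list_all2 (\<lambda>g x. g \<in> \<phi> x) gs w}"

lemma word_sets_append:
  "gs \<in> word_sets \<phi> (u @ v) \<longleftrightarrow> (\<exists>g1 g2. gs = g1 @ g2 \<and> g1 \<in> word_sets \<phi> u \<and> g2 \<in> word_sets \<phi> v)"
  unfolding word_sets_def list_all2_append2 mem_Collect_eq by (blast dest: list_all2_lengthD)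

lemma word_sets_carrier:
  "gs \<in> word_sets \<phi> w \<Longrightarrow> (\<And>n. \<phi> n \<subseteq> C) \<Longrightarrow> set gs \<subseteq> C"
  unfolding word_sets_def by (auto simp: list_all2_conv_all_nth in_set_conv_nth) blast

lemma word_sets_map: "(\<And>x. x \<in> set w \<Longrightarrow> f x \<in> \<phi> x) \<Longrightarrow> map f w \<in> word_sets \<phi> w"
  by (auto simp: word_sets_def list_all2_conv_all_nth)

text \<open>Stated for monoids and only through the two operations, so that it covers both power
  semirings of a group and also sets of multisets.\<close>

lemma eval_term_words:
  assumes G: "monoid G" and \<phi>: "\<And>n. \<phi> n \<subseteq> carrier G"
    and S: "splus S = (\<union>)" "stimes S = set_mult G"
  shows "eval_term S \<phi> p = (\<Union>w\<in>words p. mprod G ` word_sets \<phi> w)"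
proof (induction p)
  case (Var n)
  interpret monoid G by fact
  show ?case
  proof
    show "eval_term S \<phi> (Var n) \<subseteq> (\<Union>w\<in>words (Var n). mprod G ` word_sets \<phi> w)"
    proof
      fix g assume "g \<in> eval_term S \<phi> (Var n)"
      then have "g \<in> \<phi> n" by simp
      then have "[g] \<in> word_sets \<phi> [n]" "g = mprod G [g]"
        using subsetD[OF \<phi>] by (auto simp: word_sets_def)
      then show "g \<in> (\<Union>w\<in>words (Var n). mprod G ` word_sets \<phi> w)"
        unfolding words.simps by blast
    qed
    show "(\<Union>w\<in>words (Var n). mprod G ` word_sets \<phi> w) \<subseteq> eval_term S \<phi> (Var n)"
      using subsetD[OF \<phi>] by (auto simp: word_sets_def list_all2_Cons2)
  qed
next
  case (Plus p q)
  then show ?case by (simp add: S)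
next
  case (Times p q)
  interpret monoid G by fact
  have *: "mprod G (g1 @ g2) = mprod G g1 \<otimes>\<^bsub>G\<^esub> mprod G g2"
    if "g1 \<in> word_sets \<phi> u" "g2 \<in> word_sets \<phi> v" for g1 g2 u v
    using that word_sets_carrier[OF _ \<phi>] by (intro mprod_append)
  show ?case
  proof (intro equalityI subsetI)
    fix g assume "g \<in> eval_term S \<phi> (Times p q)"
    then obtain u v g1 g2 where
      uv: "u \<in> words p" "v \<in> words q" and g: "g1 \<in> word_sets \<phi> u" "g2 \<in> word_sets \<phi> v"
      "g = mprod G g1 \<otimes>\<^bsub>G\<^esub> mprod G g2"
      unfolding eval_term.simps S Times set_mult_def by blast
    have "u @ v \<in> words (Times p q)" "g1 @ g2 \<in> word_sets \<phi> (u @ v)" "g = mprod G (g1 @ g2)"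
      using uv g by (auto simp: * word_sets_append)
    then show "g \<in> (\<Union>w\<in>words (Times p q). mprod G ` word_sets \<phi> w)"
      by blast
  next
    fix g assume "g \<in> (\<Union>w\<in>words (Times p q). mprod G ` word_sets \<phi> w)"
    then obtain u v gs where uv: "u \<in> words p" "v \<in> words q"
      and gs: "gs \<in> word_sets \<phi> (u @ v)" "g = mprod G gs"
      by auto
    from gs(1) obtain g1 g2 where "gs = g1 @ g2" "g1 \<in> word_sets \<phi> u" "g2 \<in> word_sets \<phi> v"
      unfolding word_sets_append by blast
    with uv gs(2) have "mprod G g1 \<in> eval_term S \<phi> p" "mprod G g2 \<in> eval_term S \<phi> q"
      "g = mprod G g1 \<otimes>\<^bsub>G\<^esub> mprod G g2"
      unfolding Times by (blast, blast, simp add: *)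
    then show "g \<in> eval_term S \<phi> (Times p q)"
      unfolding eval_term.simps S set_mult_def by blast
  qed
qed

lemma eval_power_semiring:
  assumes "monoid G" "\<And>n. \<phi> n \<subseteq> carrier G"
  shows "eval_term (power_semiring G) \<phi> p = (\<Union>w\<in>words p. mprod G ` word_sets \<phi> w)"
    and "eval_term (power_semiring0 G) \<phi> p = (\<Union>w\<in>words p. mprod G ` word_sets \<phi> w)"
  by (intro eval_term_words; (fact assms | simp add: power_semiring_def power_semiring0_def))+

section \<open>Homomorphic images\<close>

text \<open>When the kernel of \<open>f\<close> is a congruence, this is the quotient of
  \<open>P\<close> by it, realised on the values of \<open>f\<close> and hence in a type of one's
  choice.\<close>

definition image_semiring :: "('a \<Rightarrow> 'b) \<Rightarrow> 'a sr_alg \<Rightarrow> 'b sr_alg" where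
  "image_semiring f P = \<lparr>carrier = f ` carrier P,
     splus = (\<lambda>a b. f (splus P (inv_into (carrier P) f a) (inv_into (carrier P) f b))),
     stimes = (\<lambda>a b. f (stimes P (inv_into (carrier P) f a) (inv_into (carrier P) f b)))\<rparr>"

locale semiring_image = ai_semiring P for P :: "'a sr_alg" +
  fixes f :: "'a \<Rightarrow> 'b"
  assumes splus_cong: "\<lbrakk>x \<in> carrier P; x' \<in> carrier P; y \<in> carrier P; y' \<in> carrier P;
      f x = f x'; f y = f y'\<rbrakk> \<Longrightarrow> f (splus P x y) = f (splus P x' y')"
    and stimes_cong: "\<lbrakk>x \<in> carrier P; x' \<in> carrier P; y \<in> carrier P; y' \<in> carrier P;
      f x = f x'; f y = f y'\<rbrakk> \<Longrightarrow> f (stimes P x y) = f (stimes P x' y')"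
begin

lemma image_ops:
  assumes "x \<in> carrier P" "y \<in> carrier P"
  shows "splus (image_semiring f P) (f x) (f y) = f (splus P x y)"
    and "stimes (image_semiring f P) (f x) (f y) = f (stimes P x y)"
  using assms unfolding image_semiring_def
  by (auto intro!: splus_cong stimes_cong simp: inv_into_into f_inv_into_f)

lemma carrier_image: "carrier (image_semiring f P) = f ` carrier P"
  by (simp add: image_semiring_def)

lemma ai_semiring_image: "ai_semiring (image_semiring f P)"
proof (unfold_locales, goal_cases)
  case 1 then show ?case using nonempty by (simp add: carrier_image)
qed (auto simp: carrier_image image_ops splus_closed stimes_closed splus_assoc splus_idem
      stimes_assoc distrib_left distrib_right intro: arg_cong[OF splus_commute])

lemma eval_closed: "(\<And>n. \<phi> n \<in> carrier P) \<Longrightarrow> eval_term P \<phi> p \<in> carrier P"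
  by (induction p) (auto simp: splus_closed stimes_closed)

lemma eval_image:
  "(\<And>n. \<phi> n \<in> carrier P) \<Longrightarrow> eval_term (image_semiring f P) (f \<circ> \<phi>) p = f (eval_term P \<phi> p)"
  by (induction p) (auto simp: image_ops eval_closed)

text \<open>Every assignment in the image lifts to \<open>P\<close>, so validity can be tested in
  \<open>P\<close> up to the kernel of \<open>f\<close>.\<close>

lemma satisfies_image:
  "satisfies (image_semiring f P) e \<longleftrightarrow> (\<forall>\<phi>. (\<forall>n. \<phi> n \<in> carrier P) \<longrightarrow>
     f (eval_term P \<phi> (fst e)) = f (eval_term P \<phi> (snd e)))"
proof
  assume L: "satisfies (image_semiring f P) e"
  show "\<forall>\<phi>. (\<forall>n. \<phi> n \<in> carrier P) \<longrightarrow> f (eval_term P \<phi> (fst e)) = f (eval_term P \<phi> (snd e))"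
  proof (intro allI impI)
    fix \<phi> :: "nat \<Rightarrow> 'a" assume \<phi>: "\<forall>n. \<phi> n \<in> carrier P"
    then have "\<forall>n. (f \<circ> \<phi>) n \<in> carrier (image_semiring f P)"
      by (simp add: carrier_image)
    with L have "eval_term (image_semiring f P) (f \<circ> \<phi>) (fst e)
        = eval_term (image_semiring f P) (f \<circ> \<phi>) (snd e)"
      unfolding satisfies_def by blast
    then show "f (eval_term P \<phi> (fst e)) = f (eval_term P \<phi> (snd e))"
      using \<phi> by (simp add: eval_image)
  qed
next
  assume R: "\<forall>\<phi>. (\<forall>n. \<phi> n \<in> carrier P) \<longrightarrow>
     f (eval_term P \<phi> (fst e)) = f (eval_term P \<phi> (snd e))"
  show "satisfies (image_semiring f P) e"
    unfolding satisfies_def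
  proof (intro allI impI)
    fix \<psi> :: "nat \<Rightarrow> 'b" assume "\<forall>n. \<psi> n \<in> carrier (image_semiring f P)"
    then have "\<forall>n. \<exists>x. x \<in> carrier P \<and> \<psi> n = f x"
      by (auto simp: carrier_image)
    then obtain \<phi> where \<phi>: "\<And>n. \<phi> n \<in> carrier P" "\<And>n. \<psi> n = f (\<phi> n)" by metis
    then have "\<psi> = f \<circ> \<phi>" by auto
    then show "eval_term (image_semiring f P) \<psi> (fst e) = eval_term (image_semiring f P) \<psi> (snd e)"
      using R \<phi>(1) by (simp add: eval_image)
  qed
qed

end

section \<open>Colourings with a prescribed linear relation\<close>

text \<open>Every group element is a sum of two members of \<open>D\<close>, so two summands absorb
  whatever the others, chosen arbitrarily in \<open>D\<close>, leave over.\<close>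

lemma ex_sum_eq:
  fixes D :: "'a :: ab_group_add set"
  assumes D: "\<And>g. \<exists>t\<in>D. g - t \<in> D"
    and C: "finite C" "i \<in> C" "j \<in> C" "i \<noteq> j"
  shows "\<exists>t. (\<forall>k\<in>C. t k \<in> D) \<and> sum t C = g"
proof -
  have "\<exists>t. (\<forall>k\<in>insert i B. t k \<in> D) \<and> sum t (insert i B) = g"
    if "finite B" "B \<noteq> {}" "i \<notin> B" for B g
    using that
  proof (induction B arbitrary: g rule: finite_ne_induct)
    case (singleton y)
    obtain t where "t \<in> D" "g - t \<in> D" using D by blast
    then show ?case
      using singleton by (intro exI[of _ "\<lambda>k. if k = i then t else g - t"]) auto
  next
    case (insert y B)
    obtain x where x: "x \<in> D" using D by blast
    from insert.IH[of "g - x"] insert.prems obtain t where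
      t: "\<forall>k\<in>insert i B. t k \<in> D" "sum t (insert i B) = g - x" by auto
    have "sum (t(y := x)) (insert y (insert i B)) = x + sum (t(y := x)) (insert i B)"
      using insert by (subst sum.insert) auto
    also have "sum (t(y := x)) (insert i B) = sum t (insert i B)"
      using insert by (intro sum.cong) auto
    finally have "sum (t(y := x)) (insert i (insert y B)) = g"
      using t(2) by (simp add: insert_commute)
    then show ?case
      using t(1) x by (intro exI[of _ "t(y := x)"]) auto
  qed
  from this[of "C - {i}" g] show ?thesis
    using C by (auto simp: insert_absorb)
qed

text \<open>
  The sum over \<open>n\<close> telescopes to a signed sum of \<open>s\<close> over the boundary of \<open>n\<close>.
  If two boundary points have the same colour, \<open>s\<close> vanishes on the other colour class and is
  arbitrary in \<open>D\<close> on this one; otherwise \<open>n\<close> is an interval and its two ends can share a third value.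
\<close>

lemma ex_colouring:
  fixes D :: "'a :: ab_group_add set" and \<epsilon> :: "nat \<Rightarrow> bool"
  assumes D: "\<And>g. \<exists>t\<in>D. g - t \<in> D" "\<And>x. x \<in> D \<Longrightarrow> - x \<in> D"
    and R: "\<And>i j. (i, j) \<in> R \<Longrightarrow> i < j" "\<And>i j. (i, j) \<in> R \<Longrightarrow> \<epsilon> i \<noteq> \<epsilon> j"
    and n: "finite n" "\<And>i j. (i, j) \<in> R \<Longrightarrow> n \<noteq> {i..<j}"
  shows "\<exists>s. (\<forall>(i, j)\<in>R. s j - s i \<in> D) \<and> (\<Sum>l\<in>n. s (Suc l) - s l) = 0"
proof -
  \<comment> \<open>\<open>P\<close> and \<open>Q\<close> are the upper and lower boundary of
    \<open>n\<close>; all other terms of the telescoping sum cancel.\<close>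
  define P Q where "P = Suc ` n - n" and "Q = n - Suc ` n"
  have fin: "finite P" "finite Q" using n by (auto simp: P_def Q_def)
  have disj: "P \<inter> Q = {}" by (auto simp: P_def Q_def)
  have telescope: "(\<Sum>l\<in>n. s (Suc l) - s l) = sum s P - sum s Q" for s :: "nat \<Rightarrow> 'a"
  proof -
    have "sum s (Suc ` n) = sum s P + sum s (Suc ` n \<inter> n)"
      unfolding P_def using n(1) by (metis finite_imageI sum.Int_Diff add.commute)
    moreover have "sum s n = sum s Q + sum s (Suc ` n \<inter> n)"
      unfolding Q_def using n(1) by (metis sum.Int_Diff add.commute Int_commute)
    moreover have "sum s (Suc ` n) = (\<Sum>l\<in>n. s (Suc l))"
      by (simp add: sum.reindex)
    ultimately show ?thesis by (simp add: sum_subtractf)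
  qed
  \<comment> \<open>The values \<open>0\<close>, \<open>t1\<close> and \<open>t2\<close> have
    pairwise differences in \<open>D\<close>, in either order, and serve as three colours.\<close>
  obtain t1 where t1: "t1 \<in> D" using D by blast
  obtain t2 where t2: "t2 \<in> D" "t1 - t2 \<in> D" using D(1) by blast
  have t2': "t2 - t1 \<in> D" using D(2)[OF t2(2)] by simp
  have minus: "0 - x \<in> D" if "x \<in> D" for x using D(2)[OF that] by simp
  consider (empty) "n = {}"
    | (two) i j where "i \<in> P \<union> Q" "j \<in> P \<union> Q" "i \<noteq> j" "\<epsilon> i = \<epsilon> j"
    | (few) "n \<noteq> {}" "\<And>i j. i \<in> P \<union> Q \<Longrightarrow> j \<in> P \<union> Q \<Longrightarrow> i \<noteq> j \<Longrightarrow> \<epsilon> i \<noteq> \<epsilon> j"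
    by blast
  then show ?thesis
  proof cases
    case empty
    have "\<forall>(i, j)\<in>R. (if \<epsilon> j then t1 else 0) - (if \<epsilon> i then t1 else 0) \<in> D"
      using R(2) t1 minus by auto
    then show ?thesis using empty by (intro exI[of _ "\<lambda>i. if \<epsilon> i then t1 else 0"]) simp
  next
    case two
    define C where "C = {k \<in> P \<union> Q. \<epsilon> k = \<epsilon> i}"
    have "finite C" "i \<in> C" "j \<in> C"
      using two fin by (auto simp: C_def)
    from ex_sum_eq[OF D(1) this two(3)] obtain t where
      t: "\<And>k. k \<in> C \<Longrightarrow> t k \<in> D" "sum t C = 0" by metis
    \<comment> \<open>The sign change on \<open>Q\<close> turns \<open>sum s P - sum s Q\<close>
      into \<open>sum t C = 0\<close>. Points of this colour off the boundary only need some value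
      in \<open>D\<close>, here \<open>t1\<close>.\<close>
    define s where "s k = (if \<epsilon> k \<noteq> \<epsilon> i then 0 else if k \<in> P then t k else if k \<in> Q then - t k else t1)" for k
    have s0: "s k = 0" if "\<epsilon> k \<noteq> \<epsilon> i" for k
      using that by (simp add: s_def)
    have s1: "s k \<in> D" if "\<epsilon> k = \<epsilon> i" for k
      using that t(1)[of k] t1 D(2) by (auto simp: s_def C_def)
    have "s b - s a \<in> D" if "(a, b) \<in> R" for a b
    proof (cases "\<epsilon> a = \<epsilon> i")
      case True
      then show ?thesis using R(2)[OF that] s0[of b] s1[of a] minus by simp
    next
      case False
      then show ?thesis using R(2)[OF that] s0[of a] s1[of b] by simp
    qed
    moreover have "sum s P - sum s Q = 0"
    proof -
      have "sum s P = sum s (P \<inter> C)"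
        using fin by (intro sum.mono_neutral_right) (auto simp: C_def s_def)
      also have "\<dots> = sum t (P \<inter> C)"
        by (intro sum.cong) (auto simp: C_def s_def)
      finally have P: "sum s P = sum t (P \<inter> C)" .
      have "sum s Q = sum s (Q \<inter> C)"
        using fin by (intro sum.mono_neutral_right) (auto simp: C_def s_def)
      also have "\<dots> = sum (\<lambda>k. - t k) (Q \<inter> C)"
        using disj by (intro sum.cong) (auto simp: C_def s_def)
      finally have Q: "sum s Q = - sum t (Q \<inter> C)"
        by (simp add: sum_negf)
      have "sum t C = sum t ((P \<inter> C) \<union> (Q \<inter> C))"
        by (rule arg_cong[of _ _ "sum t"]) (auto simp: C_def)
      also have "\<dots> = sum t (P \<inter> C) + sum t (Q \<inter> C)"
        using fin disj by (intro sum.union_disjoint) auto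
      finally show ?thesis using P Q t(2) by simp
    qed
    ultimately show ?thesis using telescope by auto
  next
    case few
    \<comment> \<open>These are a lower and an upper boundary point. With at most one boundary point
      per colour there are no others, so \<open>n\<close> has no holes.\<close>
    define i j where "i = Min n" and "j = Suc (Max n)"
    have i: "i \<in> n" and i_le: "\<And>l. l \<in> n \<Longrightarrow> i \<le> l"
      using few n by (auto simp: i_def)
    have j: "j \<in> Suc ` n" and j_gt: "\<And>l. l \<in> n \<Longrightarrow> l < j"
      using few n by (auto simp: j_def less_Suc_eq_le)
    have iQ: "i \<in> Q" using i i_le by (fastforce simp: Q_def)
    have jP: "j \<in> P" using j j_gt by (fastforce simp: P_def)
    have ij: "i < j" using i j_gt by blast
    have \<epsilon>ij: "\<epsilon> i \<noteq> \<epsilon> j" using few(2)[of i j] iQ jP ij by blast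
    have only: "k = i \<or> k = j" if "k \<in> P \<union> Q" for k
      using few(2)[of k i] few(2)[of k j] that iQ jP \<epsilon>ij by blast
    have "i + d \<in> n" if "i + d < j" for d
      using that
    proof (induction d)
      case 0
      then show ?case using i by simp
    next
      case (Suc d)
      then have "i + d \<in> n" by simp
      then have "Suc (i + d) \<in> n \<or> Suc (i + d) \<in> P" by (auto simp: P_def)
      then show ?case using only[of "Suc (i + d)"] Suc.prems by auto
    qed
    then have sub: "{i..<j} \<subseteq> n" by (metis atLeastLessThan_iff le_iff_add subsetI)
    have neq: "n = {i..<j}"
      using sub i_le j_gt by auto
    then have notR: "(i, j) \<notin> R" using n(2) by blast
    \<comment> \<open>The ends may share \<open>t1\<close> because \<open>(i, j)\<close> is not in
      \<open>R\<close>; every edge of \<open>R\<close> still joins two different ones of the three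
      values.\<close>
    define s where "s k = (if k = i \<or> k = j then t1 else if \<epsilon> k then 0 else t2)" for k
    have "s b - s a \<in> D" if "(a, b) \<in> R" for a b
    proof -
      have "a < b" "\<epsilon> a \<noteq> \<epsilon> b" using R that by auto
      have "\<not> (a \<in> {i, j} \<and> b \<in> {i, j})"
        using \<open>a < b\<close> ij notR that by auto
      then show ?thesis
        using \<open>\<epsilon> a \<noteq> \<epsilon> b\<close> t1 t2 t2' minus by (auto simp: s_def)
    qed
    moreover have "(\<Sum>l\<in>n. s (Suc l) - s l) = 0"
    proof -
      have "(\<Sum>l\<in>n. s (Suc l) - s l) = s j - s i"
        unfolding neq using ij by (simp add: sum_Suc_diff')
      then show ?thesis by (simp add: s_def)
    qed
    ultimately show ?thesis by blast
  qed
qed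

section \<open>Power semirings of groups\<close>

text \<open>Gives access to an abelian subgroup with at least three elements in additive notation.\<close>

lemma (in group) ex_hom_int_prod:
  assumes "3 \<le> card (carrier G)"
  obtains \<psi> :: "int \<times> int \<Rightarrow> 'a" and u v where
    "\<And>x. \<psi> x \<in> carrier G" "\<And>x y. \<psi> (x + y) = \<psi> x \<otimes> \<psi> y"
    "\<psi> u \<noteq> \<one>" "\<psi> v \<noteq> \<one>" "\<psi> u \<noteq> \<psi> v"
proof -
  have "carrier G \<noteq> {\<one>}" using assms by auto
  then obtain a where a: "a \<in> carrier G" "a \<noteq> \<one>" by blast
  show thesis
  proof (cases "\<forall>x\<in>carrier G. x \<otimes> x = \<one>")
    case True
    \<comment> \<open>Exponent two makes the group abelian; the powers of two distinct nontrivial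
      elements then give the homomorphism.\<close>
    have comm: "x \<otimes> y = y \<otimes> x" if "x \<in> carrier G" "y \<in> carrier G" for x y
    proof -
      have "inv z = z" if "z \<in> carrier G" for z
        using True that by (simp add: inv_equality)
      then show ?thesis using that inv_mult_group[of x y] by simp
    qed
    interpret comm_group G by (rule group.group_comm_groupI[OF is_group comm])
    have "carrier G \<noteq> {\<one>, a}" using assms a by auto
    then obtain b where b: "b \<in> carrier G" "b \<noteq> \<one>" "b \<noteq> a" using a by auto
    define \<psi> where "\<psi> = (\<lambda>u :: int \<times> int. a [^] fst u \<otimes> b [^] snd u)"
    show thesis
    proof (rule that[of \<psi> "(1, 0)" "(0, 1)"])
      fix x y :: "int \<times> int"
      show "\<psi> x \<in> carrier G" using a b by (simp add: \<psi>_def)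
      show "\<psi> (x + y) = \<psi> x \<otimes> \<psi> y"
        using a b by (simp add: \<psi>_def int_pow_mult m_ac)
    qed (use a b in \<open>auto simp: \<psi>_def int_pow_1\<close>)
  next
    case False
    then obtain b where b: "b \<in> carrier G" "b \<otimes> b \<noteq> \<one>" by blast
    \<comment> \<open>Here \<open>\<one>\<close>, \<open>b\<close> and the square of
      \<open>b\<close> are distinct, so the cyclic subgroup generated by \<open>b\<close> is
      enough.\<close>
    have "b \<noteq> \<one>" "b \<noteq> b \<otimes> b" using b by (auto simp: l_cancel_one')
    define \<psi> where "\<psi> = (\<lambda>u :: int \<times> int. b [^] fst u)"
    show thesis
    proof (rule that[of \<psi> "(1, 0)" "(1 + 1, 0)"])
      fix x y :: "int \<times> int"
      show "\<psi> x \<in> carrier G" using b by (simp add: \<psi>_def)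
      show "\<psi> (x + y) = \<psi> x \<otimes> \<psi> y"
        using b by (simp add: \<psi>_def int_pow_mult)
      have "b [^] (1 + 1 :: int) = b \<otimes> b"
        using b(1) int_pow_mult[of b 1 1] by (simp only: int_pow_1)
      then show "\<psi> (1, 0) \<noteq> \<one>" "\<psi> (1 + 1, 0) \<noteq> \<one>" "\<psi> (1, 0) \<noteq> \<psi> (1 + 1, 0)"
        using b \<open>b \<noteq> \<one>\<close> \<open>b \<noteq> b \<otimes> b\<close> by (auto simp: \<psi>_def int_pow_1)
    qed
  qed
qed

section \<open>Substitutions that detect occurrences of variables in words\<close>

lemma word_sets_Nil: "word_sets \<phi> [] = {[]}"
  by (auto simp: word_sets_def)

lemma word_sets_Cons: "gs \<in> word_sets \<phi> (x # w) \<longleftrightarrow> (\<exists>g gs'. gs = g # gs' \<and> g \<in> \<phi> x \<and> gs' \<in> word_sets \<phi> w)"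
  by (auto simp: word_sets_def list_all2_Cons2)

text \<open>For a nontrivial \<open>h\<close> in a group: if \<open>Y\<close> is the whole group, a
  word reaches \<open>h\<close> exactly when it meets \<open>\<Xi>\<close>; if \<open>Y\<close> is
  the group without \<open>h\<close>, reaching \<open>h\<close> takes at least two letters from
  \<open>\<Xi>\<close>.\<close>

definition (in monoid) spread :: "nat set \<Rightarrow> 'a set \<Rightarrow> nat \<Rightarrow> 'a set" where
  "spread \<Xi> Y x = (if x \<in> \<Xi> then Y else {\<one>})"

context group
begin

lemma one_in_spread_words: "\<one> \<in> Y \<Longrightarrow> \<one> \<in> mprod G ` word_sets (spread \<Xi> Y) w"
  by (rule image_eqI[of _ _ "map (\<lambda>_. \<one>) w"])
    (auto intro!: word_sets_map mprod_ones[symmetric] simp: spread_def)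

lemma spread_words_at_most_one:
  assumes "gs \<in> word_sets (spread \<Xi> Y) w" "\<one> \<in> Y" "Y \<subseteq> carrier G"
  shows "set w \<inter> \<Xi> = {} \<Longrightarrow> mprod G gs = \<one>"
    and "length (filter (\<lambda>x. x \<in> \<Xi>) w) \<le> 1 \<Longrightarrow> mprod G gs \<in> Y"
proof -
  \<comment> \<open>The claims are proved together: if the first letter lies in
    \<open>\<Xi>\<close>, the rest of the word has no such letter and its product is
    \<open>\<one>\<close>.\<close>
  have *: "(set w \<inter> \<Xi> = {} \<longrightarrow> mprod G gs = \<one>) \<and>
      (length (filter (\<lambda>x. x \<in> \<Xi>) w) \<le> 1 \<longrightarrow> mprod G gs \<in> Y)"
    using assms(1)
  proof (induction w arbitrary: gs)
    case Nil
    then show ?case using assms(2) by (simp add: word_sets_Nil)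
  next
    case (Cons x w)
    then obtain g gs' where gs: "gs = g # gs'" "g \<in> spread \<Xi> Y x" "gs' \<in> word_sets (spread \<Xi> Y) w"
      by (auto simp: word_sets_Cons)
    have "set w \<inter> \<Xi> = {}" if "filter (\<lambda>x. x \<in> \<Xi>) w = []"
      using that by (auto simp: filter_empty_conv)
    moreover have "mprod G gs' \<in> carrier G"
      using gs(3) assms word_sets_carrier[of gs' "spread \<Xi> Y" w "carrier G"]
      by (intro mprod_closed) (auto simp: spread_def split: if_splits)
    ultimately show ?case
      using Cons.IH[OF gs(3)] gs(1,2) assms(3) by (auto simp: spread_def split: if_splits)
  qed
  show "set w \<inter> \<Xi> = {} \<Longrightarrow> mprod G gs = \<one>"
    and "length (filter (\<lambda>x. x \<in> \<Xi>) w) \<le> 1 \<Longrightarrow> mprod G gs \<in> Y"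
    using * by blast+
qed

lemma spread_words_one:
  assumes "set w \<inter> \<Xi> \<noteq> {}" "\<one> \<in> Y" "Y \<subseteq> carrier G" "g \<in> Y"
  shows "g \<in> mprod G ` word_sets (spread \<Xi> Y) w"
  using assms(1)
proof (induction w)
  case (Cons x w)
  show ?case
  proof (cases "x \<in> \<Xi>")
    case True
    obtain gs where gs: "gs \<in> word_sets (spread \<Xi> Y) w" "\<one> = mprod G gs"
      using one_in_spread_words[OF assms(2)] by blast
    have "g # gs \<in> word_sets (spread \<Xi> Y) (x # w)"
      using gs True assms by (auto simp: word_sets_Cons spread_def)
    moreover have "g = mprod G (g # gs)"
      using gs(2)[symmetric] assms by auto
    ultimately show ?thesis by blast
  next
    case False
    then obtain gs where gs: "gs \<in> word_sets (spread \<Xi> Y) w" "g = mprod G gs"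
      using Cons by auto
    have "\<one> # gs \<in> word_sets (spread \<Xi> Y) (x # w)"
      using gs False by (auto simp: word_sets_Cons spread_def)
    moreover have "g = mprod G (\<one> # gs)"
      using gs(2)[symmetric] assms by auto
    ultimately show ?thesis by blast
  qed
qed simp

text \<open>Choose \<open>y\<close> different from \<open>\<one>\<close> and \<open>h\<close>.
  Neither \<open>y\<close> nor \<open>inv y \<otimes> h\<close> equals \<open>h\<close>; the first
  letter from \<open>\<Xi>\<close> takes \<open>y\<close>, and the rest of the word, which still
  meets \<open>\<Xi>\<close>, takes the other factor.\<close>

lemma spread_words_two:
  assumes "2 \<le> length (filter (\<lambda>x. x \<in> \<Xi>) w)" "3 \<le> card (carrier G)" "h \<in> carrier G" "h \<noteq> \<one>"
  shows "h \<in> mprod G ` word_sets (spread \<Xi> (carrier G - {h})) w"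
  using assms(1)
proof (induction w)
  case (Cons x w)
  let ?S = "spread \<Xi> (carrier G - {h})"
  show ?case
  proof (cases "x \<in> \<Xi>")
    case True
    have "carrier G \<noteq> {\<one>, h}" using assms by auto
    then obtain y where y: "y \<in> carrier G" "y \<noteq> \<one>" "y \<noteq> h" using assms(3) by blast
    have "filter (\<lambda>x. x \<in> \<Xi>) w \<noteq> []"
      using Cons.prems True by auto
    then have "set w \<inter> \<Xi> \<noteq> {}"
      by (auto simp: filter_empty_conv)
    moreover have "inv y \<otimes> h \<in> carrier G - {h}"
      using y assms(3) by (auto simp: l_cancel_one)
    ultimately obtain gs where gs: "gs \<in> word_sets ?S w" "inv y \<otimes> h = mprod G gs"
      using spread_words_one[of w \<Xi> "carrier G - {h}" "inv y \<otimes> h"] assms by auto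
    have "y # gs \<in> word_sets ?S (x # w)"
      using gs True y by (auto simp: word_sets_Cons spread_def)
    moreover have "h = mprod G (y # gs)"
      using gs(2)[symmetric] y assms by (simp add: m_assoc[symmetric])
    ultimately show ?thesis by blast
  next
    case False
    then obtain gs where gs: "gs \<in> word_sets ?S w" "h = mprod G gs"
      using Cons by auto
    have "\<one> # gs \<in> word_sets ?S (x # w)"
      using gs False by (auto simp: word_sets_Cons spread_def)
    moreover have "h = mprod G (\<one> # gs)"
      using gs(2)[symmetric] assms by auto
    ultimately show ?thesis by blast
  qed
qed simp

end

section \<open>Counting letters in the multiset value of a word\<close>

lemma length_filter_mono:
  "(\<And>x. P x \<Longrightarrow> Q x) \<Longrightarrow> length (filter P xs) \<le> length (filter Q xs)"
  by (induction xs) auto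

lemma length_filter_le_count:
  "length (filter (\<lambda>x. a \<in># f x) v) \<le> count (\<Sum>x\<leftarrow>v. f x) a"
proof (induction v)
  case (Cons x v)
  have "Suc 0 \<le> count (f x) a" if "a \<in># f x" using that by (simp add: Suc_le_eq)
  then have "length (filter (\<lambda>x. a \<in># f x) [x]) \<le> count (f x) a" by simp
  from add_mono[OF this Cons.IH] show ?case by (simp split: if_splits)
qed simp

lemma count_le_1:
  assumes "count m a \<le> 1"
  shows "count m a = (if a \<in># m then 1 else 0)"
proof (cases "a \<in># m")
  case True
  then have "0 < count m a" by simp
  then have "count m a = 1" using assms by linarith
  then show ?thesis using True by simp
qed (simp add: count_eq_zero_iff)

lemma count_sum_list_squarefree:
  "(\<And>x. x \<in> set w \<Longrightarrow> count (f x) a \<le> 1) \<Longrightarrow>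
    count (\<Sum>x\<leftarrow>w. f x) a = length (filter (\<lambda>x. a \<in># f x) w)"
proof (induction w)
  case (Cons x w)
  then have "count (f x) a \<le> 1" by simp
  from count_le_1[OF this] show ?case using Cons by simp
qed simp

lemma count_le_count_sum_list:
  "x \<in> set v \<Longrightarrow> count (f x) a \<le> count (\<Sum>x\<leftarrow>v. f x) a"
  by (induction v) auto

text \<open>The value of the word \<open>[0..<M]\<close> after deletion of the block
  \<open>{i..<j}\<close>, when every letter stands for itself.\<close>

definition gap :: "nat \<Rightarrow> nat \<Rightarrow> nat \<Rightarrow> nat multiset" where
  "gap M i j = mset_set ({..<M} - {i..<j})"

lemma count_gap_le: "count (gap M i j) a \<le> 1"
  by (simp add: gap_def count_mset_set')

lemma set_gap: "set_mset (gap M i j) = {..<M} - {i..<j}"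
  by (simp add: gap_def)

lemma gap_inject:
  assumes "i < j" "j < M" "i' < j'" "j' < M" "gap M i j = gap M i' j'"
  shows "i = i' \<and> j = j'"
proof -
  have "{..<M} - {i..<j} = {..<M} - {i'..<j'}"
    using assms(5) by (metis set_gap)
  moreover have "{i..<j} \<subseteq> {..<M}" "{i'..<j'} \<subseteq> {..<M}"
    using assms by auto
  ultimately have "{i..<j} = {i'..<j'}"
    by (metis double_diff subset_refl)
  then show ?thesis using assms by (simp add: atLeastLessThan_eq_iff)
qed

section \<open>Local satisfaction\<close>

text \<open>
  After the first two ways of hitting \<open>h\<close> (\<open>w_vars\<close>, \<open>once\<close>), every variable of \<open>w\<close> may be given a single
  multiset and the total is squarefree, so that a colouring decides the rest.
\<close>

lemma power_semiring_word_below: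
  fixes \<phi> :: "nat \<Rightarrow> nat multiset set" and E :: "(nat \<times> nat) set"
  assumes H: "group H" "3 \<le> card (carrier H)" and sat: "satisfies (power_semiring H) (p, q)"
    and E: "\<And>i j. (i, j) \<in> E \<Longrightarrow> i < j \<and> j < M"
    and bip: "\<And>R. R \<subseteq> E \<Longrightarrow> card R \<le> 2 ^ k \<Longrightarrow> \<exists>\<epsilon> :: nat \<Rightarrow> bool. \<forall>(i, j)\<in>R. \<epsilon> i \<noteq> \<epsilon> j"
    and vars: "card (term_vars q) \<le> k"
    and \<phi>: "\<And>x. \<phi> x \<noteq> {}"
    and L: "L = (\<lambda>(i, j). gap M i j) ` E"
    and sub: "\<And>v. v \<in> words q \<Longrightarrow> sum_list ` word_sets \<phi> v \<subseteq> L"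
    and w: "w \<in> words p"
  shows "sum_list ` word_sets \<phi> w \<subseteq> L"
proof (rule ccontr)
  interpret group H by fact
  assume "\<not> sum_list ` word_sets \<phi> w \<subseteq> L"
  then obtain ms where ms: "ms \<in> word_sets \<phi> w" "sum_list ms \<notin> L" by blast
  \<comment> \<open>The identity of the power semiring enters only in this form: what
    \<open>w\<close> reaches under an assignment is reached by some word of
    \<open>q\<close>.\<close>
  have transfer: "\<exists>v\<in>words q. h \<in> mprod H ` word_sets B v"
    if B: "\<And>x. B x \<subseteq> carrier H \<and> B x \<noteq> {}" and "h \<in> mprod H ` word_sets B w" for B h
  proof -
    have "eval_term (power_semiring H) B p = eval_term (power_semiring H) B q"
      using sat B by (auto simp: satisfies_def power_semiring_def)
    then have "(\<Union>w\<in>words p. mprod H ` word_sets B w) = (\<Union>w\<in>words q. mprod H ` word_sets B w)"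
      using eval_power_semiring(1)[OF monoid_axioms, of B] B by simp
    then show ?thesis using that(2) w by blast
  qed
  have "carrier H \<noteq> {\<one>\<^bsub>H\<^esub>}" using H(2) by auto
  then obtain h where h: "h \<in> carrier H" "h \<noteq> \<one>\<^bsub>H\<^esub>" using one_closed by blast

  have w_vars: "set w \<subseteq> term_vars q"
  proof
    fix x assume x: "x \<in> set w"
    have "h \<in> mprod H ` word_sets (spread {x} (carrier H)) w"
      using spread_words_one[of w "{x}" "carrier H" h] x h by auto
    moreover have "spread {x} (carrier H) y \<subseteq> carrier H \<and> spread {x} (carrier H) y \<noteq> {}" for y
      using h by (auto simp: spread_def)
    ultimately obtain v where
      v: "v \<in> words q" "h \<in> mprod H ` word_sets (spread {x} (carrier H)) v"
      using transfer by blast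
    then have "set v \<inter> {x} \<noteq> {}"
      using spread_words_at_most_one(1)[of _ "{x}" "carrier H" v] h by auto
    then show "x \<in> term_vars q"
      using v(1) by (auto simp: term_vars_words)
  qed

  have once: "length (filter (\<lambda>x. x \<in> \<Xi>) w) \<le> 1"
    if "\<And>v. v \<in> words q \<Longrightarrow> length (filter (\<lambda>x. x \<in> \<Xi>) v) \<le> 1" for \<Xi>
  proof (rule ccontr)
    assume "\<not> length (filter (\<lambda>x. x \<in> \<Xi>) w) \<le> 1"
    then have "h \<in> mprod H ` word_sets (spread \<Xi> (carrier H - {h})) w"
      using spread_words_two[of \<Xi> w h] h H(2) by simp
    moreover have "spread \<Xi> (carrier H - {h}) y \<subseteq> carrier H \<and> spread \<Xi> (carrier H - {h}) y \<noteq> {}" for y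
      using h one_closed by (auto simp: spread_def)
    ultimately obtain v gs where
      v: "v \<in> words q" "gs \<in> word_sets (spread \<Xi> (carrier H - {h})) v" "h = mprod H gs"
      using transfer by blast
    then show False
      using spread_words_at_most_one(2)[OF v(2)] that[OF v(1)] h by auto
  qed

  have L_count: "count l a \<le> 1" "a \<in># l \<Longrightarrow> a < M" if "l \<in> L" for l a
    using that set_gap count_gap_le unfolding L by auto
  have choice_L: "(\<Sum>x\<leftarrow>v. f x) \<in> L" if "v \<in> words q" "\<And>x. f x \<in> \<phi> x" for v f
    using sub[OF that(1)] word_sets_map[of v f \<phi>] that(2) by blast

  \<comment> \<open>Two occurrences of \<open>x\<close> in a word of \<open>q\<close> would double a
    letter of a nonempty choice for \<open>x\<close>, but members of \<open>L\<close> are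
    squarefree; \<open>once\<close> carries this over to \<open>w\<close>.\<close>
  have repeat: "length (filter (\<lambda>y. y \<in> {x}) w) \<le> 1" if x: "\<phi> x \<noteq> {{#}}" for x
  proof (rule once)
    fix v assume v: "v \<in> words q"
    obtain f0 where f0: "f0 \<in> \<phi> x" "f0 \<noteq> {#}" using x \<phi>[of x] by blast
    then obtain a where a: "a \<in># f0" by blast
    define f where "f = (\<lambda>y. SOME m. m \<in> \<phi> y)(x := f0)"
    have "f y \<in> \<phi> y" for y
      using f0 \<phi> by (auto simp: f_def some_in_eq)
    then have "count (\<Sum>x\<leftarrow>v. f x) a \<le> 1"
      using choice_L[OF v] L_count(1) by blast
    moreover have "length (filter (\<lambda>y. y \<in> {x}) v) \<le> length (filter (\<lambda>y. a \<in># f y) v)"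
      using a by (intro length_filter_mono) (auto simp: f_def)
    ultimately show "length (filter (\<lambda>y. y \<in> {x}) v) \<le> 1"
      using length_filter_le_count[of a f v] by linarith
  qed

  have ms_len: "length ms = length w" and ms_nth: "\<And>i. i < length w \<Longrightarrow> ms ! i \<in> \<phi> (w ! i)"
    using ms(1) by (auto simp: word_sets_def list_all2_conv_all_nth)
  \<comment> \<open>A variable that occurs twice in \<open>w\<close> has the empty multiset as its
    only choice, so the choices in \<open>ms\<close> come from a function \<open>f\<close> of the
    variable.\<close>
  define ix where "ix x = (SOME i. i < length w \<and> w ! i = x)" for x
  define f where "f x = (if x \<in> set w then ms ! ix x else (SOME m. m \<in> \<phi> x))" for x
  have ix: "ix x < length w" "w ! ix x = x" if "x \<in> set w" for x
  proof -
    have "\<exists>i. i < length w \<and> w ! i = x" using that by (simp add: in_set_conv_nth)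
    from someI_ex[OF this] show "ix x < length w" "w ! ix x = x" unfolding ix_def by blast+
  qed
  have f\<phi>: "f x \<in> \<phi> x" for x
  proof (cases "x \<in> set w")
    case True
    then show ?thesis using ms_nth[OF ix(1)[OF True]] ix(2)[OF True] by (simp add: f_def)
  next
    case False
    then show ?thesis using \<phi>[of x] by (simp add: f_def some_in_eq)
  qed
  have "ms ! i = f (w ! i)" if i: "i < length w" for i
  proof (cases "\<phi> (w ! i) = {{#}}")
    case True
    then show ?thesis using ms_nth[OF i] f\<phi>[of "w ! i"] by simp
  next
    case False
    let ?J = "{j. j < length w \<and> w ! j = w ! i}"
    have "card ?J \<le> Suc 0"
      using repeat[OF False] by (simp add: length_filter_conv_card)
    then have "\<forall>j\<in>?J. \<forall>j'\<in>?J. j = j'"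
      using card_le_Suc0_iff_eq[of ?J] by simp
    moreover have "i \<in> ?J" using i by blast
    moreover have "ix (w ! i) \<in> ?J" using ix[OF nth_mem[OF i]] by blast
    ultimately have "ix (w ! i) = i" by blast
    then show ?thesis using nth_mem[OF i] by (simp add: f_def)
  qed
  then have "ms = map f w"
    using ms_len by (simp add: list_eq_iff_nth_eq)
  then have m_notin: "(\<Sum>x\<leftarrow>w. f x) \<notin> L" using ms(2) by simp
  have F: "(\<Sum>x\<leftarrow>v. f x) \<in> L" if "v \<in> words q" for v
    using choice_L[OF that f\<phi>] .

  have occ: "length (filter (\<lambda>x. a \<in># f x) v) \<le> 1" if "v \<in> words q" for a v
    using length_filter_le_count[of a f v] L_count(1)[OF F[OF that], of a] by linarith
  then have occ_w: "length (filter (\<lambda>x. a \<in># f x) w) \<le> 1" for a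
    using once[of "{x. a \<in># f x}"] by simp
  \<comment> \<open>By \<open>w_vars\<close> each letter of \<open>w\<close> occurs in a word of
    \<open>q\<close>, whose value lies in \<open>L\<close> and dominates \<open>f x\<close>.\<close>
  have f_L: "count (f x) a \<le> 1" "a \<in># f x \<Longrightarrow> a < M" if x: "x \<in> set w" for x a
  proof -
    obtain v where v: "v \<in> words q" "x \<in> set v"
      using subsetD[OF w_vars x] unfolding term_vars_words by blast
    have le: "count (f x) a \<le> count (\<Sum>x\<leftarrow>v. f x) a"
      using count_le_count_sum_list[OF v(2)] .
    then show "count (f x) a \<le> 1"
      using L_count(1)[OF F[OF v(1)], of a] by linarith
    assume "a \<in># f x"
    then have "a \<in># (\<Sum>x\<leftarrow>v. f x)"
      using le by (metis count_greater_zero_iff less_le_trans)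
    then show "a < M" using L_count(2)[OF F[OF v(1)]] by blast
  qed
  define m where "m = (\<Sum>x\<leftarrow>w. f x)"
  have m_count: "count m a = length (filter (\<lambda>x. a \<in># f x) w)" for a
    unfolding m_def using f_L by (intro count_sum_list_squarefree)
  have m_sub: "set_mset m \<subseteq> {..<M}"
  proof
    fix a assume "a \<in># m"
    then have "filter (\<lambda>x. a \<in># f x) w \<noteq> []"
      using m_count[of a] by (metis count_eq_zero_iff length_0_conv)
    then show "a \<in> {..<M}" using f_L(2) by (auto simp: filter_empty_conv)
  qed
  \<comment> \<open>\<open>m\<close> turns out to be squarefree and is described by its complement
    \<open>n\<close>; that \<open>m\<close> is not in \<open>L\<close> means that \<open>n\<close>
    is not the block of an edge.\<close>
  define n where "n = {..<M} - set_mset m"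
  have "finite n" "n \<subseteq> {..<M}" by (auto simp: n_def)
  have m_eq: "m = mset_set ({..<M} - n)"
  proof (rule multiset_eqI)
    fix a
    have "count m a \<le> 1" using m_count occ_w by simp
    then have "count m a = (if a \<in># m then 1 else 0)" by (rule count_le_1)
    moreover have "{..<M} - n = set_mset m" using m_sub by (auto simp: n_def)
    ultimately show "count m a = count (mset_set ({..<M} - n)) a"
      by (simp add: count_mset_set')
  qed
  have n_gap: "n \<noteq> {i..<j}" if "(i, j) \<in> E" for i j
  proof
    assume "n = {i..<j}"
    then have "m = gap M i j" by (simp add: m_eq gap_def)
    then show False using m_notin that unfolding m_def L by auto
  qed

  \<comment> \<open>Only edges realised by words of \<open>q\<close> constrain the colouring. Their
    gaps are sums of \<open>f\<close> over sets of variables of \<open>q\<close>, so there are at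
    most \<open>2 ^ k\<close> of them.\<close>
  define R where "R = {(i, j) \<in> E. gap M i j \<in> (\<lambda>v. \<Sum>x\<leftarrow>v. f x) ` words q}"
  have RE: "R \<subseteq> E" by (auto simp: R_def)
  have "card R \<le> 2 ^ k"
  proof -
    have "(\<Sum>x\<leftarrow>v. f x) \<in> sum f ` Pow (term_vars q)" if v: "v \<in> words q" for v
    proof -
      \<comment> \<open>Letters with empty value may repeat; the others cannot, so the set of these
        determines the value of the word.\<close>
      let ?v = "filter (\<lambda>x. f x \<noteq> {#}) v"
      have "distinct ?v"
      proof (rule ccontr)
        assume "\<not> distinct ?v"
        then obtain as bs cs x where d: "?v = as @ [x] @ bs @ [x] @ cs"
          using not_distinct_decomp by blast
        then have "x \<in> set ?v" by simp
        then have "f x \<noteq> {#}" by simp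
        then obtain a where a: "a \<in># f x" by blast
        have "filter (\<lambda>x. a \<in># f x) ?v = filter (\<lambda>x. a \<in># f x) v"
          by (auto intro: filter_cong)
        moreover have "2 \<le> length (filter (\<lambda>x. a \<in># f x) ?v)"
          using a by (simp add: d)
        ultimately show False using occ[OF v, of a] by simp
      qed
      then have "(\<Sum>x\<leftarrow>?v. f x) = sum f (set ?v)"
        by (rule sum_list_distinct_conv_sum_set)
      moreover have "(\<Sum>x\<leftarrow>?v. f x) = (\<Sum>x\<leftarrow>v. f x)"
        by (rule sum_list_map_filter) auto
      moreover have "set ?v \<subseteq> term_vars q"
        using v by (auto simp: term_vars_words)
      ultimately show ?thesis by auto
    qed
    then have "(\<lambda>(i, j). gap M i j) ` R \<subseteq> sum f ` Pow (term_vars q)"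
      by (auto simp: R_def)
    then have "card ((\<lambda>(i, j). gap M i j) ` R) \<le> card (sum f ` Pow (term_vars q))"
      by (intro card_mono) (auto simp: finite_term_vars)
    also have "\<dots> \<le> card (Pow (term_vars q))"
      by (intro card_image_le) (simp add: finite_term_vars)
    also have "\<dots> \<le> 2 ^ k"
      using vars by (simp add: card_Pow finite_term_vars)
    finally have "card ((\<lambda>(i, j). gap M i j) ` R) \<le> 2 ^ k" .
    moreover have "inj_on (\<lambda>(i, j). gap M i j) R"
    proof (rule inj_onI, clarsimp)
      fix i j i' j' assume "(i, j) \<in> R" "(i', j') \<in> R" "gap M i j = gap M i' j'"
      then show "i = i' \<and> j = j'"
        using E[of i j] E[of i' j'] RE by (intro gap_inject[of i j M]) auto
    qed
    ultimately show ?thesis by (simp add: card_image)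
  qed
  from bip[OF RE this] obtain \<epsilon> :: "nat \<Rightarrow> bool"
    where \<epsilon>: "\<And>i j. (i, j) \<in> R \<Longrightarrow> \<epsilon> i \<noteq> \<epsilon> j" by blast

  obtain \<psi> :: "int \<times> int \<Rightarrow> 'a" and t1 t2 where
    \<psi>: "\<And>x. \<psi> x \<in> carrier H" "\<And>x y. \<psi> (x + y) = \<psi> x \<otimes>\<^bsub>H\<^esub> \<psi> y"
      "\<psi> t1 \<noteq> \<one>\<^bsub>H\<^esub>" "\<psi> t2 \<noteq> \<one>\<^bsub>H\<^esub>" "\<psi> t1 \<noteq> \<psi> t2"
    using ex_hom_int_prod[OF H(2)] by metis
  have "\<psi> 0 \<otimes>\<^bsub>H\<^esub> \<psi> 0 = \<psi> 0" using \<psi>(2)[of 0 0] by simp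
  then have \<psi>0: "\<psi> 0 = \<one>\<^bsub>H\<^esub>" using \<psi>(1)[of 0] l_cancel_one' by metis
  have \<psi>_eq: "\<psi> x = \<psi> y" if "\<psi> (x - y) = \<one>\<^bsub>H\<^esub>" for x y
    using \<psi>(2)[of "x - y" y] \<psi>(1)[of y] that by simp
  have \<psi>_diff: "\<psi> y = \<one>\<^bsub>H\<^esub>" if "\<psi> (x - y) = \<psi> x" for x y
    using \<psi>(2)[of "x - y" y] \<psi>(1) that by (simp add: l_cancel_one')
  \<comment> \<open>\<open>D\<close> is the complement of the kernel of \<open>\<psi>\<close>. One
    of \<open>\<psi> t1\<close> and \<open>\<psi> t2\<close> differs from \<open>\<psi> g\<close>,
    which yields the required splitting of \<open>g\<close>.\<close>
  define D where "D = {x. \<psi> x \<noteq> \<one>\<^bsub>H\<^esub>}"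
  have D1: "\<exists>t\<in>D. g - t \<in> D" for g
  proof (cases "\<psi> g = \<psi> t1")
    case True
    then show ?thesis using \<psi> \<psi>_eq[of g t2] by (intro bexI[of _ t2]) (auto simp: D_def)
  next
    case False
    then show ?thesis using \<psi> \<psi>_eq[of g t1] by (intro bexI[of _ t1]) (auto simp: D_def)
  qed
  have D2: "- x \<in> D" if "x \<in> D" for x
    using that \<psi>_eq[of 0 x] \<psi>0 by (auto simp: D_def)
  have "\<exists>s. (\<forall>(i, j)\<in>R. s j - s i \<in> D) \<and> (\<Sum>l\<in>n. s (Suc l) - s l) = 0"
  proof (rule ex_colouring[OF D1 D2 _ \<epsilon> \<open>finite n\<close>])
    fix i j assume "(i, j) \<in> R"
    then have "(i, j) \<in> E" using RE by blast
    then show "i < j" "n \<noteq> {i..<j}" using E n_gap by auto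
  qed
  then obtain s where s: "\<And>i j. (i, j) \<in> R \<Longrightarrow> s j - s i \<in> D" "(\<Sum>l\<in>n. s (Suc l) - s l) = 0"
    by blast
  \<comment> \<open>The letter \<open>l\<close> weighs \<open>s (Suc l) - s l\<close>, so deleting
    the block of \<open>(i, j)\<close> lowers the weight of the full word by
    \<open>s j - s i\<close>.\<close>
  define val where "val X = (\<Sum>l\<in>#X. s (Suc l) - s l)" for X
  have val_set: "val (mset_set ({..<M} - A)) = s M - s 0 - (\<Sum>l\<in>A. s (Suc l) - s l)"
    if "A \<subseteq> {..<M}" for A
  proof -
    have "val (mset_set ({..<M} - A)) = (\<Sum>l\<in>{..<M} - A. s (Suc l) - s l)"
      by (simp add: val_def sum_unfold_sum_mset)
    also have "\<dots> = (\<Sum>l<M. s (Suc l) - s l) - (\<Sum>l\<in>A. s (Suc l) - s l)"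
      using that by (intro sum_diff) auto
    finally show ?thesis by (simp add: sum_lessThan_telescope)
  qed
  define B where "B x = {\<psi> (val (f x))}" for x
  have word_B: "word_sets B v = {map (\<lambda>x. \<psi> (val (f x))) v}" for v
    by (induction v) (auto simp: word_sets_Nil word_sets_Cons B_def set_eq_iff)
  have prod_B: "mprod H (map (\<lambda>x. \<psi> (val (f x))) v) = \<psi> (val (\<Sum>x\<leftarrow>v. f x))" for v
    by (induction v) (simp_all add: val_def \<psi>0 \<psi>(2))
  \<comment> \<open>The letters in \<open>n\<close> have total weight zero, so \<open>w\<close>
    weighs as much as the full word. A word of \<open>q\<close> with the same image under
    \<open>\<psi>\<close> forces \<open>s j - s i\<close> into the kernel for some edge of
    \<open>R\<close>.\<close>
  have "val m = s M - s 0"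
    unfolding m_eq using val_set[OF \<open>n \<subseteq> {..<M}\<close>] s(2) by simp
  then have "\<psi> (s M - s 0) \<in> mprod H ` word_sets B w"
    by (simp add: word_B prod_B flip: m_def)
  moreover have "B x \<subseteq> carrier H \<and> B x \<noteq> {}" for x
    using \<psi>(1) by (auto simp: B_def)
  ultimately obtain v where v: "v \<in> words q" "\<psi> (s M - s 0) \<in> mprod H ` word_sets B v"
    using transfer by blast
  from F[OF v(1)] obtain i j where ij: "(i, j) \<in> E" "(\<Sum>x\<leftarrow>v. f x) = gap M i j"
    unfolding L by auto
  then have "(i, j) \<in> R" using v(1) unfolding R_def by force
  have ijM: "i < j" "j < M" using E ij by auto
  have "val (gap M i j) = s M - s 0 - (s j - s i)"
    unfolding gap_def using ijM by (subst val_set) (auto simp: sum_Suc_diff')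
  moreover have "\<psi> (s M - s 0) = \<psi> (val (gap M i j))"
    using v(2) unfolding word_B image_insert prod_B ij(2) by blast
  ultimately have "\<psi> (s M - s 0 - (s j - s i)) = \<psi> (s M - s 0)" by (simp only:)
  then have "\<psi> (s j - s i) = \<one>\<^bsub>H\<^esub>" by (rule \<psi>_diff)
  moreover have "\<psi> (s j - s i) \<noteq> \<one>\<^bsub>H\<^esub>"
    using s(1)[OF \<open>(i, j) \<in> R\<close>] unfolding D_def by blast
  ultimately show False by blast
qed

section \<open>The residual semiring\<close>

definition additive_monoid :: "'a::comm_monoid_add monoid" where
  "additive_monoid = \<lparr>carrier = UNIV, monoid.mult = (+), one = 0\<rparr>"

lemma monoid_additive: "monoid additive_monoid"
  by unfold_locales (auto simp: additive_monoid_def add.assoc)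

lemma mprod_additive: "mprod additive_monoid = sum_list"
proof
  fix gs :: "'a list"
  show "mprod additive_monoid gs = sum_list gs"
    by (induction gs) (auto simp: additive_monoid_def)
qed

lemma ai_semiring_additive: "ai_semiring (power_semiring additive_monoid)"
proof -
  show ?thesis
  proof (unfold_locales, goal_cases)
    case 1
    show ?case by (auto simp: power_semiring_def additive_monoid_def)
  next
    case (3 X Y)
    then show ?case
      by (auto simp: power_semiring_def additive_monoid_def set_mult_def)
  next
    case (7 X Y Z)
    have "set_mult additive_monoid (set_mult additive_monoid X Y) Z =
        set_mult additive_monoid X (set_mult additive_monoid Y Z)"
      unfolding set_mult_def additive_monoid_def by (auto simp: add.assoc)
    then show ?case by (simp add: power_semiring_def)
  qed (simp_all add: power_semiring_def set_mult_Un Un_ac)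
qed

text \<open>Equality of residuals is the syntactic congruence of \<open>L\<close>: two sets are
  identified when the same translates of them lie inside \<open>L\<close>.\<close>

definition residual :: "'a::comm_monoid_add set \<Rightarrow> 'a set \<Rightarrow> 'a set" where
  "residual L X = {t. \<forall>x\<in>X. t + x \<in> L}"

lemma residual_Un: "residual L (X \<union> Y) = residual L X \<inter> residual L Y"
  by (auto simp: residual_def)

lemma residual_times:
  "residual L (X <#>\<^bsub>additive_monoid\<^esub> Y) = {t. \<forall>y\<in>Y. t + y \<in> residual L X}"
  by (auto simp: residual_def set_mult_def additive_monoid_def add.assoc) (metis add.commute)+

lemma residual_times':
  "residual L (X <#>\<^bsub>additive_monoid\<^esub> Y) = {t. \<forall>x\<in>X. t + x \<in> residual L Y}"
  by (auto simp: residual_def set_mult_def additive_monoid_def add.assoc)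

text \<open>Each of the two formulas for the residual of a product involves one factor only through
  its residual, so the factors are exchanged one after the other.\<close>

lemma residual_times_cong:
  assumes "residual L X = residual L X'" "residual L Y = residual L Y'"
  shows "residual L (X <#>\<^bsub>additive_monoid\<^esub> Y) = residual L (X' <#>\<^bsub>additive_monoid\<^esub> Y')"
  using residual_times[of L X Y] residual_times[of L X' Y] residual_times'[of L X' Y]
    residual_times'[of L X' Y'] assms by simp

text \<open>\<open>g\<close> renames residuals by elements of another type; injectivity on the
  residuals that occur keeps the kernel unchanged.\<close>

lemma semiring_image_residual:
  assumes "inj_on g (residual L ` {X. X \<noteq> {}})"
  shows "semiring_image (power_semiring additive_monoid) (g \<circ> residual L)"
proof -
  have *: "residual L X = residual L Y"
    if "X \<in> carrier (power_semiring additive_monoid)" "Y \<in> carrier (power_semiring additive_monoid)"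
      "(g \<circ> residual L) X = (g \<circ> residual L) Y" for X Y
    using that by (auto simp: power_semiring_def additive_monoid_def dest!: inj_onD[OF assms])
  interpret ai_semiring "power_semiring additive_monoid :: 'a set sr_alg"
    by (rule ai_semiring_additive)
  show ?thesis
  proof unfold_locales
    fix X X' Y Y' :: "'a set"
    assume "X \<in> carrier (power_semiring additive_monoid)" "X' \<in> carrier (power_semiring additive_monoid)"
      "Y \<in> carrier (power_semiring additive_monoid)" "Y' \<in> carrier (power_semiring additive_monoid)"
      "(g \<circ> residual L) X = (g \<circ> residual L) X'" "(g \<circ> residual L) Y = (g \<circ> residual L) Y'"
    then have eq: "residual L X = residual L X'" "residual L Y = residual L Y'"
      using * by blast+
    show "(g \<circ> residual L) (splus (power_semiring additive_monoid) X Y) =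
        (g \<circ> residual L) (splus (power_semiring additive_monoid) X' Y')"
      using eq by (simp add: power_semiring_def residual_Un)
    show "(g \<circ> residual L) (stimes (power_semiring additive_monoid) X Y) =
        (g \<circ> residual L) (stimes (power_semiring additive_monoid) X' Y')"
      using residual_times_cong[OF eq] by (simp add: power_semiring_def)
  qed
qed

lemma satisfies_residual:
  assumes "inj_on g (residual L ` {X. X \<noteq> {}})"
  shows "satisfies (image_semiring (g \<circ> residual L) (power_semiring additive_monoid)) e \<longleftrightarrow>
    (\<forall>\<phi>. (\<forall>n. \<phi> n \<noteq> {}) \<longrightarrow>
      residual L (eval_term (power_semiring additive_monoid) \<phi> (fst e)) =
      residual L (eval_term (power_semiring additive_monoid) \<phi> (snd e)))"
proof -
  interpret semiring_image "power_semiring additive_monoid" "g \<circ> residual L"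
    by (rule semiring_image_residual[OF assms])
  have car: "X \<in> carrier (power_semiring additive_monoid) \<longleftrightarrow> X \<noteq> {}" for X :: "'a set"
    by (simp add: power_semiring_def additive_monoid_def)
  have "g (residual L (eval_term (power_semiring additive_monoid) \<phi> p)) =
      g (residual L (eval_term (power_semiring additive_monoid) \<phi> q)) \<longleftrightarrow>
      residual L (eval_term (power_semiring additive_monoid) \<phi> p) =
      residual L (eval_term (power_semiring additive_monoid) \<phi> q)"
    if "\<forall>n. \<phi> n \<noteq> {}" for \<phi> p q
    using eval_closed[of \<phi> p] eval_closed[of \<phi> q] that
    by (intro inj_on_eq_iff[OF assms]) (auto simp: car)
  then show ?thesis
    unfolding satisfies_image car by auto
qed

lemma eval_additive:
  "eval_term (power_semiring additive_monoid) \<phi> p = (\<Union>w\<in>words p. sum_list ` word_sets \<phi> w)"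
  using eval_power_semiring(1)[OF monoid_additive, of \<phi> p]
  by (simp add: additive_monoid_def mprod_additive[unfolded additive_monoid_def])

lemma finite_submultisets: "finite {A. A \<subseteq># B}"
proof (rule finite_subset)
  show "{A. A \<subseteq># B} \<subseteq> mset ` {xs. set xs \<subseteq> set_mset B \<and> length xs \<le> size B}"
  proof
    fix A assume A: "A \<in> {A. A \<subseteq># B}"
    obtain xs where "mset xs = A" using ex_mset by blast
    then show "A \<in> mset ` {xs. set xs \<subseteq> set_mset B \<and> length xs \<le> size B}"
      using A by (force dest: mset_subset_eqD size_mset_mono)
  qed
qed (simp add: finite_lists_length_le)

text \<open>If \<open>X\<close> is nonempty, a member of its residual is a submultiset of a member
  of \<open>L\<close>. Finiteness lets the quotient be copied into any infinite type.\<close>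

lemma finite_residuals:
  fixes L :: "'b multiset set"
  assumes "finite L"
  shows "finite (residual L ` {X. X \<noteq> {}})"
proof (rule finite_subset)
  show "residual L ` {X. X \<noteq> {}} \<subseteq> Pow (\<Union>l\<in>L. {A. A \<subseteq># l})"
    by (fastforce simp: residual_def)
qed (use assms finite_submultisets in auto)

text \<open>A fresh variable with value \<open>{t}\<close>, multiplied to both sides, absorbs the
  translation by \<open>t\<close>; it accounts for the \<open>Suc k\<close>.\<close>

lemma power_semiring_residual_le:
  fixes \<phi> :: "nat \<Rightarrow> nat multiset set" and E :: "(nat \<times> nat) set"
  assumes H: "group H" "3 \<le> card (carrier H)" and sat: "satisfies (power_semiring H) (p, q)"
    and E: "\<And>i j. (i, j) \<in> E \<Longrightarrow> i < j \<and> j < M"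
    and bip: "\<And>R. R \<subseteq> E \<Longrightarrow> card R \<le> 2 ^ Suc k \<Longrightarrow> \<exists>\<epsilon> :: nat \<Rightarrow> bool. \<forall>(i, j)\<in>R. \<epsilon> i \<noteq> \<epsilon> j"
    and vars: "card (term_vars p \<union> term_vars q) \<le> k"
    and \<phi>: "\<And>x. \<phi> x \<noteq> {}"
    and L: "L = (\<lambda>(i, j). gap M i j) ` E"
  shows "residual L (eval_term (power_semiring additive_monoid) \<phi> q) \<subseteq>
    residual L (eval_term (power_semiring additive_monoid) \<phi> p)"
proof
  fix t assume t: "t \<in> residual L (eval_term (power_semiring additive_monoid) \<phi> q)"
  obtain z where z: "z \<notin> term_vars p \<union> term_vars q"
    using ex_new_if_finite[of "term_vars p \<union> term_vars q"] finite_term_vars infinite_UNIV_nat by blast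
  define \<phi>' where "\<phi>' = \<phi>(z := {t})"
  have words_Times: "sum_list ` word_sets \<phi>' (z # v) = (\<lambda>x. t + x) ` sum_list ` word_sets \<phi> v"
    if "v \<in> words p \<union> words q" for v
  proof -
    have "z \<notin> set v" using that z by (auto simp: term_vars_words)
    then have "word_sets \<phi>' v = word_sets \<phi> v"
      by (induction v) (auto simp: word_sets_Nil word_sets_Cons \<phi>'_def set_eq_iff)
    moreover have "word_sets \<phi>' (z # v) = (#) t ` word_sets \<phi>' v"
      by (auto simp: word_sets_Cons \<phi>'_def)
    ultimately show ?thesis by (simp add: image_image)
  qed
  have below: "sum_list ` word_sets \<phi>' w \<subseteq> L" if "w \<in> words (Times (Var z) p)" for w
  proof (rule power_semiring_word_below[OF H _ E bip _ _ L _ that])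
    show "satisfies (power_semiring H) (Times (Var z) p, Times (Var z) q)"
      using sat by (simp add: satisfies_def)
    show "card (term_vars (Times (Var z) q)) \<le> Suc k"
    proof -
      have "card (term_vars q) \<le> card (term_vars p \<union> term_vars q)"
        by (intro card_mono) (auto simp: finite_term_vars)
      then show ?thesis using vars by (simp add: card_insert_if finite_term_vars)
    qed
    show "\<phi>' x \<noteq> {}" for x
      using \<phi> by (simp add: \<phi>'_def)
    show "sum_list ` word_sets \<phi>' v \<subseteq> L" if v: "v \<in> words (Times (Var z) q)" for v
    proof -
      obtain v' where "v = z # v'" "v' \<in> words q" using v by auto
      have "t + x \<in> L" if "x \<in> sum_list ` word_sets \<phi> v'" for x
        using t that \<open>v' \<in> words q\<close> unfolding residual_def eval_additive by blast
      then show ?thesis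
        using words_Times[of v'] \<open>v' \<in> words q\<close> \<open>v = z # v'\<close> by auto
    qed
  qed
  show "t \<in> residual L (eval_term (power_semiring additive_monoid) \<phi> p)"
    unfolding residual_def eval_additive
  proof (clarify, goal_cases)
    case (1 x w gs)
    have "z # w \<in> words (Times (Var z) p)" using 1 by auto
    from below[OF this] show ?case using words_Times[of w] 1 by blast
  qed
qed

section \<open>The separating identity\<close>

lemma ex_word_term: "w \<noteq> [] \<Longrightarrow> \<exists>p. words p = {w}"
proof (induction w rule: list_nonempty_induct)
  case (single x)
  have "words (Var x) = {[x]}" by simp
  then show ?case by blast
next
  case (cons x xs)
  then obtain p where "words p = {xs}" by blast
  then have "words (Times (Var x) p) = {x # xs}" by simp
  then show ?case by blast
qed

lemma ex_sum_term: "finite W \<Longrightarrow> W \<noteq> {} \<Longrightarrow> [] \<notin> W \<Longrightarrow> \<exists>p. words p = W"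
proof (induction W rule: finite_ne_induct)
  case (singleton w)
  then show ?case using ex_word_term by simp
next
  case (insert w W)
  then obtain q where "words q = W" by auto
  moreover obtain p where "words p = {w}" using ex_word_term[of w] insert.prems by auto
  ultimately have "words (Plus p q) = insert w W" by simp
  then show ?case by blast
qed

definition gap_word :: "nat \<Rightarrow> nat \<Rightarrow> nat \<Rightarrow> nat list" where
  "gap_word M i j = [0..<i] @ [j..<M]"

text \<open>
  Partial products colour the vertices of the graph by group elements; an edge with
  both ends of the same colour is a block of the word with product 1.
\<close>

lemma group_word_subset:
  assumes G: "group G" "finite (carrier G)" "card (carrier G) \<le> N"
    and \<phi>: "\<And>x. \<phi> x \<subseteq> carrier G"
    and E: "\<And>i j. (i, j) \<in> E \<Longrightarrow> i < j \<and> j < M"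
    and chrom: "\<And>c :: nat \<Rightarrow> nat. c ` {..<M} \<subseteq> {..<N} \<Longrightarrow> \<exists>(i, j)\<in>E. c i = c j"
  shows "mprod G ` word_sets \<phi> [0..<M] \<subseteq> (\<Union>(i, j)\<in>E. mprod G ` word_sets \<phi> (gap_word M i j))"
proof
  interpret group G by fact
  fix g assume "g \<in> mprod G ` word_sets \<phi> [0..<M]"
  then obtain gs where gs: "gs \<in> word_sets \<phi> [0..<M]" "g = mprod G gs" by blast
  have len: "length gs = M" and nth: "\<And>i. i < M \<Longrightarrow> gs ! i \<in> \<phi> i"
    using gs(1) by (auto simp: word_sets_def list_all2_conv_all_nth)
  have gs_car: "set gs \<subseteq> carrier G"
    using word_sets_carrier[OF gs(1)] \<phi> by blast
  have car: "mprod G (take i gs) \<in> carrier G" "mprod G (drop i gs) \<in> carrier G" for i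
    using gs_car by (auto intro!: mprod_closed dest: in_set_takeD in_set_dropD)
  have split: "g = mprod G (take i gs) \<otimes>\<^bsub>G\<^esub> mprod G (drop i gs)" for i
    using gs(2) mprod_append[of "take i gs" "drop i gs"] gs_car
    by (auto dest: in_set_takeD in_set_dropD)
  obtain enc where enc: "bij_betw enc (carrier G) {0..<card (carrier G)}"
    using ex_bij_betw_finite_nat[OF G(2)] by blast
  have "(\<lambda>i. enc (mprod G (take i gs))) ` {..<M} \<subseteq> {..<N}"
    using less_le_trans[OF _ G(3)] bij_betw_apply[OF enc car(1)] by (auto simp: image_subset_iff)
  from chrom[OF this] obtain i j where ij: "(i, j) \<in> E"
    "enc (mprod G (take i gs)) = enc (mprod G (take j gs))" by blast
  then have eq: "mprod G (take i gs) = mprod G (take j gs)"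
    using enc car(1) by (meson bij_betw_imp_inj_on inj_onD)
  have "i < j" "j < M" using E[OF ij(1)] by auto
  have "g = mprod G (take i gs) \<otimes>\<^bsub>G\<^esub> mprod G (drop j gs)"
    using split[of j] eq by simp
  also have "\<dots> = mprod G (take i gs @ drop j gs)"
    using gs_car by (intro mprod_append[symmetric]) (auto dest: in_set_takeD in_set_dropD)
  finally have "g = mprod G (take i gs @ drop j gs)" .
  moreover have "take i gs @ drop j gs \<in> word_sets \<phi> (gap_word M i j)"
    unfolding gap_word_def word_sets_append
    using nth len \<open>i < j\<close> \<open>j < M\<close>
    by (intro exI conjI refl) (auto simp: word_sets_def list_all2_conv_all_nth)
  ultimately show "g \<in> (\<Union>(i, j)\<in>E. mprod G ` word_sets \<phi> (gap_word M i j))"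
    using ij(1) by blast
qed

lemma word_sets_singletons:
  "gs \<in> word_sets (\<lambda>l. {{#l#}}) w \<longleftrightarrow> gs = map (\<lambda>l. {#l#}) w"
  by (induction w arbitrary: gs) (auto simp: word_sets_Nil word_sets_Cons)

lemma sum_list_singletons: "(\<Sum>l\<leftarrow>w. {#l#}) = mset w"
  by (induction w) auto

lemma mset_gap_word: "i < j \<Longrightarrow> j < M \<Longrightarrow> mset (gap_word M i j) = gap M i j"
proof -
  assume "i < j" "j < M"
  then have "{..<M} - {i..<j} = {0..<i} \<union> {j..<M}" by auto
  moreover have "mset_set ({0..<i} \<union> {j..<M}) = mset_set {0..<i} + mset_set {j..<M}"
    using \<open>i < j\<close> by (intro mset_set_Union) auto
  ultimately show ?thesis by (simp add: gap_word_def gap_def)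
qed

text \<open>Chromatic number above \<open>N\<close> makes \<open>e\<close> valid in the group power
  semirings; bipartiteness of small edge sets makes the identities in at most \<open>k\<close>
  variables valid in \<open>S\<close>, the semiring of residuals copied into the target
  type.\<close>

lemma ex_locally_satisfying_semiring:
  fixes H :: "'h monoid"
  assumes H: "group H" "3 \<le> card (carrier H)"
  obtains S :: "'u::infinite sr_alg" and e where "ai_semiring S"
    and "\<And>e'. satisfies (power_semiring H) e' \<Longrightarrow> card (identity_vars e') \<le> k \<Longrightarrow> satisfies S e'"
    and "\<And>G :: 'g monoid. group G \<Longrightarrow> finite (carrier G) \<Longrightarrow> card (carrier G) \<le> N \<Longrightarrow>
      satisfies (power_semiring0 G) e"
    and "\<not> satisfies S e"
proof -
  obtain M :: nat and E :: "(nat \<times> nat) set" where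
    E: "\<And>i j. (i, j) \<in> E \<Longrightarrow> i < j \<and> j < M"
    and chrom: "\<And>c :: nat \<Rightarrow> nat. c ` {..<M} \<subseteq> {..<Suc N} \<Longrightarrow> \<exists>(i, j) \<in> E. c i = c j"
    and bip: "\<And>R. R \<subseteq> E \<Longrightarrow> card R \<le> 2 ^ Suc k \<Longrightarrow> \<exists>\<epsilon> :: nat \<Rightarrow> bool. \<forall>(i, j) \<in> R. \<epsilon> i \<noteq> \<epsilon> j"
    using ex_locally_bipartite_graph[of "Suc N" "2 ^ Suc k"] by metis
  have "E \<noteq> {}" using chrom[of "\<lambda>_. 0"] by auto
  have finE: "finite E"
    by (rule finite_subset[of _ "{..<M} \<times> {..<M}"]) (use E in fastforce)+
  have "M > 0" using \<open>E \<noteq> {}\<close> E by fastforce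
  define L where "L = (\<lambda>(i, j). gap M i j) ` E"
  have finL: "finite L" using finE by (simp add: L_def)
  obtain g :: "nat multiset set \<Rightarrow> 'u" where g: "inj_on g (residual L ` {X. X \<noteq> {}})"
    using arb_inj_on_finite_infinite[OF finite_residuals[OF finL]] by blast
  define S where "S = image_semiring (g \<circ> residual L) (power_semiring additive_monoid)"
  interpret semiring_image "power_semiring additive_monoid" "g \<circ> residual L"
    by (rule semiring_image_residual[OF g])
  have sat_S: "satisfies S e \<longleftrightarrow> (\<forall>\<phi>. (\<forall>n. \<phi> n \<noteq> {}) \<longrightarrow>
      residual L (eval_term (power_semiring additive_monoid) \<phi> (fst e)) =
      residual L (eval_term (power_semiring additive_monoid) \<phi> (snd e)))" for e
    unfolding S_def by (rule satisfies_residual[OF g])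
  define W where "W = (\<lambda>(i, j). gap_word M i j) ` E"
  \<comment> \<open>As \<open>j < M\<close> for every edge, the last letter always survives; the
    empty word could not be written as a term.\<close>
  have "[] \<notin> W"
    using E by (force simp: W_def gap_word_def)
  then obtain q where q: "words q = W"
    using ex_sum_term[of W] finE \<open>E \<noteq> {}\<close> by (auto simp: W_def)
  obtain p where p: "words p = {[0..<M]}"
    using ex_word_term[of "[0..<M]"] \<open>M > 0\<close> by auto
  show thesis
  \<comment> \<open>In the semilattice order this identity says that \<open>p\<close> lies below
    \<open>q\<close>.\<close>
  proof (rule that[of S "(Plus p q, q)"])
    show "ai_semiring S"
      unfolding S_def by (rule ai_semiring_image)
  next
    fix e' assume e': "satisfies (power_semiring H) e'" "card (identity_vars e') \<le> k"
    obtain a b where ab: "e' = (a, b)" by (cases e')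
    have ba: "satisfies (power_semiring H) (b, a)"
      using e'(1) by (simp add: satisfies_def ab)
    have vars: "card (term_vars a \<union> term_vars b) \<le> k" "card (term_vars b \<union> term_vars a) \<le> k"
      using e'(2) by (simp_all add: ab identity_vars_def Un_commute)
    show "satisfies S e'"
      unfolding sat_S ab fst_conv snd_conv
    proof (intro allI impI equalityI)
      fix \<phi> :: "nat \<Rightarrow> nat multiset set" assume \<phi>: "\<forall>n. \<phi> n \<noteq> {}"
      show "residual L (eval_term (power_semiring additive_monoid) \<phi> a)
          \<subseteq> residual L (eval_term (power_semiring additive_monoid) \<phi> b)"
        by (rule power_semiring_residual_le[OF H ba E bip vars(2) _ L_def]) (use \<phi> in auto)
      show "residual L (eval_term (power_semiring additive_monoid) \<phi> b)
          \<subseteq> residual L (eval_term (power_semiring additive_monoid) \<phi> a)"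
        by (rule power_semiring_residual_le[OF H e'(1)[unfolded ab] E bip vars(1) _ L_def])
          (use \<phi> in auto)
    qed
  next
    fix G :: "'g monoid" assume G: "group G" "finite (carrier G)" "card (carrier G) \<le> N"
    show "satisfies (power_semiring0 G) (Plus p q, q)"
      unfolding satisfies_def
    proof (intro allI impI)
      fix \<phi> :: "nat \<Rightarrow> 'g set" assume "\<forall>n. \<phi> n \<in> carrier (power_semiring0 G)"
      then have \<phi>: "\<phi> x \<subseteq> carrier G" for x by (simp add: power_semiring0_def)
      have "mprod G ` word_sets \<phi> [0..<M] \<subseteq> (\<Union>(i, j)\<in>E. mprod G ` word_sets \<phi> (gap_word M i j))"
        by (rule group_word_subset[OF G(1,2) le_SucI[OF G(3)] \<phi> E chrom])
      also have "\<dots> = (\<Union>w\<in>W. mprod G ` word_sets \<phi> w)"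
        unfolding W_def by (simp add: case_prod_unfold)
      finally have "eval_term (power_semiring0 G) \<phi> p \<subseteq> eval_term (power_semiring0 G) \<phi> q"
        unfolding eval_power_semiring(2)[OF group.is_monoid[OF G(1)] \<phi>] p q by simp
      then show "eval_term (power_semiring0 G) \<phi> (fst (Plus p q, q)) =
          eval_term (power_semiring0 G) \<phi> (snd (Plus p q, q))"
        by (auto simp: power_semiring0_def)
    qed
  next
    show "\<not> satisfies S (Plus p q, q)"
    proof
      assume sat: "satisfies S (Plus p q, q)"
      \<comment> \<open>Every variable stands for itself: the words of \<open>q\<close> get values
        in \<open>L\<close>, while \<open>[0..<M]\<close> gets the full multiset, which is no gap
        because \<open>i < j\<close>.\<close>
      define \<phi> :: "nat \<Rightarrow> nat multiset set" where "\<phi> = (\<lambda>l. {{#l#}})"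
      have word: "sum_list ` word_sets \<phi> w = {mset w}" for w
        by (auto simp: \<phi>_def word_sets_singletons sum_list_singletons image_def)
      have "residual L (eval_term (power_semiring additive_monoid) \<phi> (Plus p q)) =
          residual L (eval_term (power_semiring additive_monoid) \<phi> q)"
        using sat unfolding sat_S by (simp add: \<phi>_def)
      moreover have "0 \<in> residual L (eval_term (power_semiring additive_monoid) \<phi> q)"
        unfolding residual_def eval_additive word q
        using E by (auto simp: W_def L_def mset_gap_word)
      ultimately have "0 \<in> residual L (eval_term (power_semiring additive_monoid) \<phi> (Plus p q))"
        by simp
      then have "mset [0..<M] \<in> L"
        unfolding residual_def eval_additive word words.simps p by simp
      then obtain i j where ij: "(i, j) \<in> E" "mset [0..<M] = gap M i j"
        unfolding L_def by auto
      then have "{0..<M} = {..<M} - {i..<j}"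
        by (metis set_gap set_mset_mset set_upt)
      then show False using E[OF ij(1)] by fastforce
    qed
  qed
qed


section \<open>From the separating semiring to the varieties of the interval\<close>

lemma models_mono: "\<Sigma> \<subseteq> \<Sigma>' \<Longrightarrow> models \<Sigma>' \<subseteq> models \<Sigma>"
  by (auto simp: models_def)

text \<open>A finite basis involves boundedly many variables; the \<open>Suc\<close> in
  \<open>k\<close> keeps the bound positive even for an empty basis.\<close>

lemma not_finitely_based_if_infinite_rank:
  assumes "infinite_axiomatic_rank V"
  shows "\<not> finitely_based V"
proof
  assume "finitely_based V"
  then obtain \<Sigma> where \<Sigma>: "finite \<Sigma>" "is_basis \<Sigma> V"
    unfolding finitely_based_def by blast
  define k where "k = Suc (\<Sum>e\<in>\<Sigma>. card (identity_vars e))"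
  let ?\<Sigma>' = "{e \<in> identities V. card (identity_vars e) \<le> k}"
  have "card (identity_vars e) \<le> k" if "e \<in> \<Sigma>" for e
    unfolding k_def using member_le_sum[OF that, of "\<lambda>e. card (identity_vars e)"] \<Sigma>(1) by simp
  then have "\<Sigma> \<subseteq> ?\<Sigma>'"
    using \<Sigma>(2) by (auto simp: is_basis_def)
  then have "is_basis ?\<Sigma>' V"
    using \<Sigma>(2) models_mono[of \<Sigma> ?\<Sigma>'] unfolding is_basis_def by blast
  then show False
    using assms by (auto simp: infinite_axiomatic_rank_def k_def)
qed

text \<open>Finiteness gives \<open>P\<close> an isomorphic copy in the type \<open>'u\<close>; this
  copy belongs to the generated variety, so the identities of that variety hold in
  \<open>P\<close>.\<close>

lemma identities_finite_algebra:
  assumes "ai_semiring P" "finite (carrier P)"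
  shows "identities (generated_variety {P} :: 'u::infinite sr_alg set) \<subseteq> identities {P}"
proof
  fix e assume e: "e \<in> identities (generated_variety {P} :: 'u sr_alg set)"
  interpret ai_semiring P by fact
  obtain g :: "'a \<Rightarrow> 'u" where g: "inj_on g (carrier P)"
    using arb_inj_on_finite_infinite[OF assms(2)] by blast
  interpret semiring_image P g
    using g by unfold_locales (auto dest: inj_onD)
  have sat: "satisfies (image_semiring g P) e' \<longleftrightarrow> satisfies P e'" for e'
    unfolding satisfies_image unfolding satisfies_def
    using inj_on_eq_iff[OF g eval_closed eval_closed] by (intro iff_allI imp_cong refl) auto
  have "image_semiring g P \<in> models (identities {P})"
    using ai_semiring_image sat by (auto simp: models_def identities_def)
  then have "image_semiring g P \<in> generated_variety {P}"
    using assms(1) generated_variety_eq[of "{P}"] by auto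
  then show "e \<in> identities {P}"
    using e sat[of e] unfolding identities_def by blast
qed

theorem theorem1p1:
  fixes G :: "nat \<Rightarrow> 'g monoid" and t :: nat and H :: "'h monoid"
    and \<V> :: "'u::infinite sr_alg set"
  assumes "t \<ge> 1"
    and "\<And>i. i \<in> {1..t} \<Longrightarrow> group (G i)"
    and "\<And>i. i \<in> {1..t} \<Longrightarrow> finite (carrier (G i))"
    and "group H" and "finite (carrier H)" and "card (carrier H) \<ge> 3"
    and "variety \<V>"
    and "generated_variety {power_semiring H} \<subseteq> \<V>"
    and "\<V> \<subseteq> generated_variety ((\<lambda>i. power_semiring0 (G i)) ` {1..t})"
  shows "infinite_axiomatic_rank \<V> \<and> \<not> finitely_based \<V>"
proof -
  have "infinite_axiomatic_rank \<V>"
    unfolding infinite_axiomatic_rank_def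
  proof (intro allI impI notI)
    fix k :: nat
    assume basis: "is_basis {e \<in> identities \<V>. card (identity_vars e) \<le> k} \<V>"
    define N where "N = (\<Sum>i\<in>{1..t}. card (carrier (G i)))"
    obtain S :: "'u sr_alg" and e where S: "ai_semiring S"
      "\<And>e'. satisfies (power_semiring H) e' \<Longrightarrow> card (identity_vars e') \<le> k \<Longrightarrow> satisfies S e'"
      "\<not> satisfies S e"
      and e: "\<And>G :: 'g monoid. group G \<Longrightarrow> finite (carrier G) \<Longrightarrow> card (carrier G) \<le> N \<Longrightarrow>
        satisfies (power_semiring0 G) e"
      using ex_locally_satisfying_semiring[OF assms(4,6)] by metis
    have "card (carrier (G i)) \<le> N" if "i \<in> {1..t}" for i
      unfolding N_def using member_le_sum[OF that, of "\<lambda>i. card (carrier (G i))"] by simp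
    then have "e \<in> identities ((\<lambda>i. power_semiring0 (G i)) ` {1..t})"
      using e assms(2,3) by (auto simp: identities_def)
    moreover have "\<V> \<subseteq> models (identities ((\<lambda>i. power_semiring0 (G i)) ` {1..t}))"
      using assms(9) generated_variety_eq[of "(\<lambda>i. power_semiring0 (G i)) ` {1..t}"]
        ai_semiring_power_semiring0 assms(2) by blast
    ultimately have "e \<in> identities \<V>"
      unfolding identities_def[of \<V>] models_def by blast
    \<comment> \<open>The upper bound on \<open>\<V>\<close> made \<open>e\<close> one of its
      identities. The lower bound makes all its identities hold in the power semiring of
      \<open>H\<close>, so those in at most \<open>k\<close> variables hold in \<open>S\<close>,
      where \<open>e\<close> fails.\<close>
    have "identities \<V> \<subseteq> identities (generated_variety {power_semiring H} :: 'u sr_alg set)"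
      using assms(8) by (auto simp: identities_def)
    also have "\<dots> \<subseteq> identities {power_semiring H}"
      using assms(4,5) by (intro identities_finite_algebra ai_semiring_power_semiring)
        (auto simp: power_semiring_def)
    finally have "S \<in> models {e \<in> identities \<V>. card (identity_vars e) \<le> k}"
      using S(1,2) by (auto simp: models_def identities_def)
    then show False
      using basis \<open>e \<in> identities \<V>\<close> S(3) by (auto simp: is_basis_def)
  qed
  then show ?thesis
    using not_finitely_based_if_infinite_rank by blast
qed

end
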